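(* Let $G$ be a locally compact second countable group and let $\mu$ be an admissible Borel probability measure on $G$. Then every $\mu$-boundary $(X,\kappa)$ admits a hitting model.
   Context: $\mu$ is generating if the closed semigroup generated by $\mathrm{supp}(\mu)$ is $G$, and admissible if it is generating and absolutely continuous with respect to Haar measure. A function $h\colon G\to\mathbb{C}$ is $\mu$-harmonic if it is measurable and $h(g)=\int_G h(g\gamma)\,d\mu(\gamma)$ for all $g$; $H^\infty(G,\mu)$ denotes the bounded $\mu$-harmonic functions. A probability $G$-space $(X,\kappa)$ ($X$ a standard Borel space with a measurable $G$-action) is $\mu$-stationary if $\kappa=\int_G g\kappa\,d\mu(g)$. The Poisson boundary of $(G,\mu)$ is the $\mu$-stationary probability $G$-space $(B,\nu_B)$ (unique up to $G$-equivariant isomorphism modulo null sets) for which $f\mapsto\left(g\mapsto\int_B f(gx)\,d\nu_B(x)\right)$ is an isometric isomorphism of $L^\infty(B,\nu_B)$ onto $H^\infty(G,\mu)$. A $\mu$-boundary is a $G$-factor $(X,\kappa)$ of the Poisson boundary: there is a measurable map $\pi\colon B\to X$ with $\pi_*\nu_B=\kappa$ and, for every $g\in G$, $\pi(gb)=g\pi(b)$ for $\nu_B$-a.e. $b$. The $\mu$-random walk is $w_0=e$, $w_n=s_1\cdots s_n$ with $s_i$ i.i.d. of law $\mu$. A hitting model for a $\mu$-boundary $(X,\kappa)$ is a topological space whose underlying set is a disjoint union $G\cup K$, with $K$ a $G$-space, such that almost every path $(w_n)$ of the $\mu$-random walk converges to a point of $K$ (the limit point in $K$ being almost surely unique, so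 that its law $\nu\in\mathrm{Prob}(K)$, the hitting measure, is well defined), and such that $(K,\nu)$ is $G$-equivariantly isomorphic to $(X,\kappa)$ as a probability space modulo null sets. Neither $K$ nor $G\cup K$ is required to be compact. *)

theory Defs
  imports "HOL-Probability.Probability" "HOL-Probability.Essential_Supremum"
begin

text \<open>
  Topological groups are written additively, since \<^class>\<open>topological_group_add\<close> is the
  library's class of (not necessarily commutative) topological groups: \<open>g + h\<close> is the group
  product and \<open>0\<close> the identity. A probability space \<open>(X, \<kappa>)\<close> is a single \<^typ>\<open>'x measure\<close>.
\<close>

section \<open>Admissible measures\<close>

definition measure_support :: "'g::topological_space measure \<Rightarrow> 'g set" where
  "measure_support \<mu> = {x. \<forall>U. open U \<and> x \<in> U \<longrightarrow> emeasure \<mu> U > 0}"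

definition closed_semigroup :: "'g::{topological_space, plus} set \<Rightarrow> bool" where
  "closed_semigroup S \<longleftrightarrow> closed S \<and> (\<forall>x\<in>S. \<forall>y\<in>S. x + y \<in> S)"

definition generating :: "'g::{topological_space, plus} measure \<Rightarrow> bool" where
  "generating \<mu> \<longleftrightarrow> closed_semigroup hull (measure_support \<mu>) = UNIV"

text \<open>On a locally compact second countable Hausdorff group, Borel measures that are finite on
  compact sets are automatically regular, so regularity is not part of the definition. Left and
  right Haar measures have the same null sets.\<close>

definition haar_measure :: "'g::topological_group_add measure \<Rightarrow> bool" where
  "haar_measure m \<longleftrightarrow>
     sets m = sets borel \<and> emeasure m UNIV \<noteq> 0 \<and>
     (\<forall>C. compact C \<longrightarrow> emeasure m C < \<infinity>) \<and>
     (\<forall>g. distr m borel (\<lambda>x. g + x) = m)"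

definition admissible :: "'g::topological_group_add measure \<Rightarrow> bool" where
  "admissible \<mu> \<longleftrightarrow> generating \<mu> \<and> (\<exists>m. haar_measure m \<and> absolutely_continuous m \<mu>)"

section \<open>Bounded harmonic functions\<close>

definition harmonic :: "'g::topological_group_add measure \<Rightarrow> ('g \<Rightarrow> complex) \<Rightarrow> bool" where
  "harmonic \<mu> h \<longleftrightarrow>
     h \<in> borel_measurable borel \<and>
     (\<forall>g. integrable \<mu> (\<lambda>\<gamma>. h (g + \<gamma>)) \<and> h g = (\<integral>\<gamma>. h (g + \<gamma>) \<partial>\<mu>))"

definition bounded_harmonic :: "'g::topological_group_add measure \<Rightarrow> ('g \<Rightarrow> complex) set" where
  "bounded_harmonic \<mu> = {h. harmonic \<mu> h \<and> bounded (range h)}"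

section \<open>Probability spaces with a group action\<close>

definition borel_of :: "'a topology \<Rightarrow> 'a measure" where
  "borel_of T = sigma (topspace T) {U. openin T U}"

definition standard_borel :: "'a measure \<Rightarrow> bool" where
  "standard_borel M \<longleftrightarrow>
     (\<exists>T. completely_metrizable_space T \<and> second_countable T \<and>
          space M = topspace T \<and> sets M = sets (borel_of T))"

definition g_space :: "'x measure \<Rightarrow> ('g::topological_group_add \<Rightarrow> 'x \<Rightarrow> 'x) \<Rightarrow> bool" where
  "g_space X act \<longleftrightarrow>
     standard_borel X \<and>
     (\<lambda>(g, x). act g x) \<in> borel \<Otimes>\<^sub>M X \<rightarrow>\<^sub>M X \<and>
     (\<forall>x\<in>space X. act 0 x = x) \<and>
     (\<forall>g h. \<forall>x\<in>space X. act (g + h) x = act g (act h x))"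

definition prob_g_space :: "'x measure \<Rightarrow> ('g::topological_group_add \<Rightarrow> 'x \<Rightarrow> 'x) \<Rightarrow> bool" where
  "prob_g_space \<kappa> act \<longleftrightarrow> prob_space \<kappa> \<and> g_space \<kappa> act"

definition stationary ::
  "'g::topological_group_add measure \<Rightarrow> 'x measure \<Rightarrow> ('g \<Rightarrow> 'x \<Rightarrow> 'x) \<Rightarrow> bool" where
  "stationary \<mu> \<kappa> act \<longleftrightarrow>
     (\<forall>A\<in>sets \<kappa>. emeasure \<kappa> A = (\<integral>\<^sup>+ g. emeasure (distr \<kappa> \<kappa> (act g)) A \<partial>\<mu>))"

definition g_factor_map ::
  "'b measure \<Rightarrow> ('g \<Rightarrow> 'b \<Rightarrow> 'b) \<Rightarrow> 'x measure \<Rightarrow> ('g \<Rightarrow> 'x \<Rightarrow> 'x) \<Rightarrow> ('b \<Rightarrow> 'x) \<Rightarrow> bool" where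
  "g_factor_map \<nu> actB \<kappa> actX \<pi> \<longleftrightarrow>
     \<pi> \<in> \<nu> \<rightarrow>\<^sub>M \<kappa> \<and> distr \<nu> \<kappa> \<pi> = \<kappa> \<and>
     (\<forall>g. AE b in \<nu>. \<pi> (actB g b) = actX g (\<pi> b))"

definition g_isomorphic ::
  "'b measure \<Rightarrow> ('g \<Rightarrow> 'b \<Rightarrow> 'b) \<Rightarrow> 'x measure \<Rightarrow> ('g \<Rightarrow> 'x \<Rightarrow> 'x) \<Rightarrow> bool" where
  "g_isomorphic \<nu> actB \<kappa> actX \<longleftrightarrow>
     (\<exists>\<phi> \<psi>. g_factor_map \<nu> actB \<kappa> actX \<phi> \<and> g_factor_map \<kappa> actX \<nu> actB \<psi> \<and>
            (AE b in \<nu>. \<psi> (\<phi> b) = b) \<and> (AE x in \<kappa>. \<phi> (\<psi> x) = x))"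

section \<open>The Poisson boundary and its factors\<close>

text \<open>Elements of \<open>L\<^sup>\<infinity>\<close> are represented by functions; equality in \<open>L\<^sup>\<infinity>\<close> is equality
  almost everywhere.\<close>

definition linf :: "'b measure \<Rightarrow> ('b \<Rightarrow> complex) set" where
  "linf \<nu> = {f \<in> borel_measurable \<nu>. \<exists>C. AE x in \<nu>. cmod (f x) \<le> C}"

definition poisson_transform ::
  "'b measure \<Rightarrow> ('g \<Rightarrow> 'b \<Rightarrow> 'b) \<Rightarrow> ('b \<Rightarrow> complex) \<Rightarrow> 'g \<Rightarrow> complex" where
  "poisson_transform \<nu> act f g = (\<integral>x. f (act g x) \<partial>\<nu>)"

text \<open>The clauses on the transform say, in order: it is well defined on \<open>L\<^sup>\<infinity>(\<nu>)\<close>, it takes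
  values in the bounded harmonic functions, it is additive and homogeneous, it is isometric
  (essential supremum norm to supremum norm), and it is onto.\<close>

definition poisson_boundary ::
  "'g::topological_group_add measure \<Rightarrow> 'b measure \<Rightarrow> ('g \<Rightarrow> 'b \<Rightarrow> 'b) \<Rightarrow> bool" where
  "poisson_boundary \<mu> \<nu> act \<longleftrightarrow>
     prob_g_space \<nu> act \<and> stationary \<mu> \<nu> act \<and>
     (\<forall>f\<in>linf \<nu>. \<forall>f'\<in>linf \<nu>. (AE x in \<nu>. f x = f' x) \<longrightarrow>
        poisson_transform \<nu> act f = poisson_transform \<nu> act f') \<and>
     (\<forall>f\<in>linf \<nu>. poisson_transform \<nu> act f \<in> bounded_harmonic \<mu>) \<and>
     (\<forall>f\<in>linf \<nu>. \<forall>f'\<in>linf \<nu>. \<forall>g.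
        poisson_transform \<nu> act (\<lambda>x. f x + f' x) g =
        poisson_transform \<nu> act f g + poisson_transform \<nu> act f' g) \<and>
     (\<forall>f\<in>linf \<nu>. \<forall>c g.
        poisson_transform \<nu> act (\<lambda>x. c * f x) g = c * poisson_transform \<nu> act f g) \<and>
     (\<forall>f\<in>linf \<nu>.
        (SUP g. ereal (cmod (poisson_transform \<nu> act f g))) =
        esssup \<nu> (\<lambda>x. ereal (cmod (f x)))) \<and>
     (\<forall>h\<in>bounded_harmonic \<mu>. \<exists>f\<in>linf \<nu>. poisson_transform \<nu> act f = h)"

text \<open>\<open>(X, \<kappa>)\<close> is a boundary as a factor of the given Poisson boundary \<open>(B, \<nu>)\<close>.\<close>

definition mu_boundary ::
  "'g::topological_group_add measure \<Rightarrow> 'b measure \<Rightarrow> ('g \<Rightarrow> 'b \<Rightarrow> 'b) \<Rightarrow>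
   'x measure \<Rightarrow> ('g \<Rightarrow> 'x \<Rightarrow> 'x) \<Rightarrow> bool" where
  "mu_boundary \<mu> \<nu> actB \<kappa> actX \<longleftrightarrow>
     poisson_boundary \<mu> \<nu> actB \<and> prob_g_space \<kappa> actX \<and>
     (\<exists>\<pi>. g_factor_map \<nu> actB \<kappa> actX \<pi>)"

section \<open>Random walk and hitting models\<close>

text \<open>The increment \<open>s\<^sub>i\<close> of the walk is the coordinate \<open>s (i - 1)\<close>.\<close>

definition increments :: "'g measure \<Rightarrow> (nat \<Rightarrow> 'g) measure" where
  "increments \<mu> = (\<Pi>\<^sub>M i\<in>UNIV. \<mu>)"

primrec walk :: "(nat \<Rightarrow> 'g::monoid_add) \<Rightarrow> nat \<Rightarrow> 'g" where
  "walk s 0 = 0"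
| "walk s (Suc n) = walk s n + s n"

definition walk_limit ::
  "('g::monoid_add + 'k) topology \<Rightarrow> 'k set \<Rightarrow> (nat \<Rightarrow> 'g) \<Rightarrow> 'k \<Rightarrow> bool" where
  "walk_limit T K s k \<longleftrightarrow> k \<in> K \<and> limitin T (\<lambda>n. Inl (walk s n)) (Inr k) sequentially"

text \<open>The Borel structure of the subspace \<open>K\<close> of \<open>G \<union> K\<close>.\<close>

definition boundary_borel :: "('g + 'k) topology \<Rightarrow> 'k set \<Rightarrow> 'k measure" where
  "boundary_borel T K = borel_of (pullback_topology K Inr T)"

text \<open>The limit is defined on almost every path only; its law is that of a measurable map \<open>\<xi>\<close>
  agreeing with it almost surely.\<close>

definition hitting_measure ::
  "'g::monoid_add measure \<Rightarrow> ('g + 'k) topology \<Rightarrow> 'k set \<Rightarrow> 'k measure \<Rightarrow> bool" where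
  "hitting_measure \<mu> T K \<nu> \<longleftrightarrow>
     (AE s in increments \<mu>. \<exists>!k. walk_limit T K s k) \<and>
     (\<exists>\<xi>. \<xi> \<in> increments \<mu> \<rightarrow>\<^sub>M boundary_borel T K \<and>
          (AE s in increments \<mu>. walk_limit T K s (\<xi> s)) \<and>
          \<nu> = distr (increments \<mu>) (boundary_borel T K) \<xi>)"

definition hitting_model ::
  "'g::topological_group_add measure \<Rightarrow> 'x measure \<Rightarrow> ('g \<Rightarrow> 'x \<Rightarrow> 'x) \<Rightarrow>
   ('g + 'k) topology \<Rightarrow> 'k set \<Rightarrow> ('g \<Rightarrow> 'k \<Rightarrow> 'k) \<Rightarrow> bool" where
  "hitting_model \<mu> \<kappa> actX T K actK \<longleftrightarrow>
     topspace T = range Inl \<union> Inr ` K \<and>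
     g_space (boundary_borel T K) actK \<and>
     (\<exists>\<nu>. hitting_measure \<mu> T K \<nu> \<and> g_isomorphic \<nu> actK \<kappa> actX)"

end

theory Submission
  imports Defs
begin

text \<open>
  For a Borel set \<open>A\<close> of \<open>X\<close> put \<open>h\<^sub>A(g) = \<kappa>(g\<^sup>-\<^sup>1A)\<close>, the Poisson transform of the indicator function
  of the preimage of \<open>A\<close> in the Poisson boundary. The transform is a linear isometry onto the bounded
  harmonic functions and preserves constants, so its inverse preserves order. The second
  moments \<open>E[h\<^sub>A(g w\<^sub>n)\<^sup>2]\<close> increase to a harmonic function of \<open>g\<close>, which by order considerations
  is \<open>h\<^sub>A\<close> itself. Hence \<open>E[h\<^sub>A(w\<^sub>n)(1 - h\<^sub>A(w\<^sub>n))]\<close> tends to \<open>0\<close>, and the maximal inequality for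
  the harmonic functions \<open>h\<^sub>A\<close> and \<open>1 - h\<^sub>A\<close> makes \<open>h\<^sub>A(w\<^sub>n)\<close> converge almost surely to \<open>0\<close> or \<open>1\<close>.

  Fix a complete separable metric on \<open>X\<close>. Almost surely the sets \<open>A\<close> of a countable base for which
  \<open>h\<^sub>A(w\<^sub>n)\<close> tends to \<open>1\<close> include sets of arbitrarily small diameter and any finitely many of them
  meet, so they shrink to a point \<open>\<xi>\<close>, whose law is \<open>\<kappa>\<close>. Declaring \<open>{g. h\<^sub>U(g) > 1/2} \<union> U\<close> to be open
  for every open \<open>U\<close> of \<open>X\<close> makes the walk converge to \<open>\<xi>\<close> and to no other point of \<open>X\<close>.
\<close>

section \<open>Harmonic functions along the random walk\<close>

lemma walk_case_nat: "walk (case_nat \<gamma> s) (Suc n) = \<gamma> + walk s n"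
  for \<gamma> :: "'g::monoid_add"
  by (induction n) (simp_all add: add.assoc)

lemma walk_comb_seq_le: "k \<le> n \<Longrightarrow> walk (comb_seq n s t) k = walk s k"
  by (induction k) (simp_all add: comb_seq_less)

text \<open>\<open>comb_seq n s t\<close> follows the increments of \<open>s\<close> up to time
  \<open>n\<close> and those of \<open>t\<close> afterwards, so this is the algebra behind the
  Markov property at time \<open>n\<close>.\<close>

lemma walk_comb_seq: "walk (comb_seq n s t) (n + k) = walk s n + walk t k"
  by (induction k) (simp_all add: walk_comb_seq_le add.assoc comb_seq_def[of n s t "n + _"])

text \<open>\<open>S\<close> is the law of the increments. Second countability makes the group
  operation measurable for the product of the Borel sigma-algebras, on which the Fubini arguments
  below rest.\<close>

locale random_walk = sequence_space \<mu>
  for \<mu> :: "'g::{topological_group_add, second_countable_topology} measure" +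
  assumes sets_step [measurable_cong]: "sets \<mu> = sets borel"
begin

lemma space_step: "space \<mu> = UNIV"
  using sets_eq_imp_space_eq[OF sets_step] by simp

lemma measurable_cons: "(\<lambda>(\<gamma>, s). case_nat \<gamma> s) \<in> \<mu> \<Otimes>\<^sub>M S \<rightarrow>\<^sub>M S"
  unfolding split_beta' by measurable

lemma space_path: "space S = UNIV"
  by (auto simp: space_PiM space_step)

lemma measurable_walk [measurable]: "(\<lambda>s. walk s n) \<in> S \<rightarrow>\<^sub>M borel"
proof (induction n)
  case (Suc n)
  note [measurable] = Suc
  have [measurable]: "(\<lambda>s. s n) \<in> S \<rightarrow>\<^sub>M borel"
    using measurable_component_singleton[of n UNIV "\<lambda>_. \<mu>"]
    by (simp add: measurable_cong_sets[OF refl sets_step])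
  show ?case by simp
qed simp

section \<open>Harmonic functions with values in the unit interval and the Markov operator\<close>

definition unit_harmonic :: "('g \<Rightarrow> real) \<Rightarrow> bool" where
  "unit_harmonic h \<longleftrightarrow> h \<in> borel_measurable borel \<and> (\<forall>g. h g \<in> {0..1}) \<and>
     (\<forall>g. (\<integral>\<gamma>. h (g + \<gamma>) \<partial>\<mu>) = h g)"

lemma integrable_shift:
  assumes [measurable]: "\<phi> \<in> borel_measurable borel" and "\<And>g. \<phi> g \<in> {0..1::real}"
  shows "integrable \<mu> (\<lambda>\<gamma>. \<phi> (g + \<gamma>))"
  using assms(2) by (intro M.integrable_const_bound[where B=1]) auto

lemma unit_harmonic_compl:
  assumes "unit_harmonic h"
  shows "unit_harmonic (\<lambda>g. 1 - h g)"
  using assms integrable_shift[of h] unfolding unit_harmonic_def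
  by (auto simp: M.prob_space)

text \<open>The powers of the Markov operator of the walk. The recursion peels off the first step,
  matching \<open>walk_case_nat\<close>.\<close>

primrec transition :: "nat \<Rightarrow> ('g \<Rightarrow> real) \<Rightarrow> 'g \<Rightarrow> real" where
  "transition 0 \<phi> g = \<phi> g"
| "transition (Suc n) \<phi> g = (\<integral>\<gamma>. transition n \<phi> (g + \<gamma>) \<partial>\<mu>)"

lemma integral_unit_interval:
  assumes "\<And>g. \<phi> g \<in> {0..1::real}"
  shows "(\<integral>\<gamma>. \<phi> (g + \<gamma>) \<partial>\<mu>) \<in> {0..1}"
proof -
  \<comment> \<open>\<open>\<phi>\<close> may be non-measurable here: a non-integrable function has
    integral \<open>0\<close> by convention.\<close>
  have "(\<integral>\<gamma>. \<phi> (g + \<gamma>) \<partial>\<mu>) \<le> 1"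
    by (cases "integrable \<mu> (\<lambda>\<gamma>. \<phi> (g + \<gamma>))")
       (use assms in \<open>auto intro!: M.integral_le_const simp: not_integrable_integral_eq\<close>)
  moreover have "(\<integral>\<gamma>. \<phi> (g + \<gamma>) \<partial>\<mu>) \<ge> 0"
    using assms by (intro integral_nonneg_AE) auto
  ultimately show ?thesis by simp
qed

lemma
  assumes [measurable]: "\<phi> \<in> borel_measurable borel" and \<phi>: "\<And>g. \<phi> g \<in> {0..1}"
  shows transition_measurable [measurable]: "transition n \<phi> \<in> borel_measurable borel"
    and transition_unit_interval: "transition n \<phi> g \<in> {0..1}"
proof -
  show "transition n \<phi> \<in> borel_measurable borel"
  proof (induction n)
    case 0
    have "transition 0 \<phi> = \<phi>" by auto
    then show ?case by simp
  next
    case (Suc n)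
    note [measurable] = Suc
    have "transition (Suc n) \<phi> = (\<lambda>g. \<integral>\<gamma>. transition n \<phi> (g + \<gamma>) \<partial>\<mu>)" by auto
    moreover have "(\<lambda>g. \<integral>\<gamma>. transition n \<phi> (g + \<gamma>) \<partial>\<mu>) \<in> borel_measurable borel"
      by (rule M.borel_measurable_lebesgue_integral) measurable
    ultimately show ?case by simp
  qed
  show "transition n \<phi> g \<in> {0..1}"
  proof (induction n arbitrary: g)
    case (Suc n)
    then show ?case using integral_unit_interval[of "transition n \<phi>" g] by simp
  qed (use \<phi> in simp)
qed

text \<open>Prepending an independent step leaves the law of the increments unchanged
  (\<open>PiM_iter\<close>), so Fubini reduces \<open>n + 1\<close> steps from \<open>g\<close> to
  \<open>n\<close> steps from \<open>g + \<gamma>\<close>.\<close>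

lemma expectation_walk:
  assumes [measurable]: "\<phi> \<in> borel_measurable borel" and \<phi>: "\<And>g. \<phi> g \<in> {0..1::real}"
  shows "(\<integral>s. \<phi> (g + walk s n) \<partial>S) = transition n \<phi> g"
proof (induction n arbitrary: g)
  case 0
  then show ?case by (simp add: P.prob_space)
next
  case (Suc n)
  interpret pair: pair_prob_space \<mu> S ..
  have "(\<integral>s. \<phi> (g + walk s (Suc n)) \<partial>S) =
      (\<integral>s. \<phi> (g + walk s (Suc n)) \<partial>distr (\<mu> \<Otimes>\<^sub>M S) S (\<lambda>(\<gamma>, s). case_nat \<gamma> s))"
    by (simp only: PiM_iter)
  also have "\<dots> = (\<integral>p. \<phi> (g + (fst p + walk (snd p) n)) \<partial>(\<mu> \<Otimes>\<^sub>M S))"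
    by (subst integral_distr[OF measurable_cons]) (simp_all add: split_beta walk_case_nat del: walk.simps)
  also have "\<dots> = (\<integral>\<gamma>. \<integral>s. \<phi> (g + (\<gamma> + walk s n)) \<partial>S \<partial>\<mu>)"
    using \<phi> by (subst pair.integral_fst'[symmetric]) (auto intro!: pair.P.integrable_const_bound[where B=1])
  also have "\<dots> = transition (Suc n) \<phi> g"
    using Suc by (simp add: add.assoc[symmetric])
  finally show ?case .
qed

lemma transition_harmonic:
  assumes "unit_harmonic h"
  shows "transition n h g = h g"
  using assms by (induction n arbitrary: g) (simp_all add: unit_harmonic_def)

section \<open>Maximal inequality\<close>

text \<open>Induction on the horizon, for all starting points at once. From a point where
  \<open>h\<close> is at least \<open>c\<close> the bound is at least \<open>1\<close>; from any
  other point the level has to be reached after the first step, and averaging the inductive bound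
  over that step gives back \<open>h g / c\<close> by harmonicity.\<close>

lemma maximal_inequality_finite:
  assumes "unit_harmonic h" and "c > 0"
  shows "emeasure S {s. \<exists>k\<le>N. c \<le> h (g + walk s k)} \<le> ennreal (h g / c)"
proof (induction N arbitrary: g)
  case 0
  show ?case
    using P.emeasure_space_1 \<open>c > 0\<close> by (simp add: space_path)
next
  case (Suc N)
  have h [measurable]: "h \<in> borel_measurable borel" and h01: "\<And>g. h g \<in> {0..1}"
    and mean: "\<And>g. (\<integral>\<gamma>. h (g + \<gamma>) \<partial>\<mu>) = h g"
    using assms by (auto simp: unit_harmonic_def)
  let ?E = "\<lambda>N g. {s. \<exists>k\<le>N. c \<le> h (g + walk s k)}"
  have E [measurable]: "?E N g \<in> sets S" for N g
  proof -
    have "{s \<in> space S. \<exists>k\<le>N. c \<le> h (g + walk s k)} \<in> sets S" by measurable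
    then show ?thesis by (simp add: space_path)
  qed
  show ?case
  proof (cases "c \<le> h g")
    case True
    have "emeasure S (?E (Suc N) g) \<le> 1"
      by (rule P.emeasure_le_1)
    also have "\<dots> \<le> ennreal (h g / c)" using True \<open>c > 0\<close> by simp
    finally show ?thesis .
  next
    case False
    let ?f = "\<lambda>(\<gamma>, s). case_nat \<gamma> s"
    have *: "case_nat \<gamma> s \<in> ?E (Suc N) g \<longleftrightarrow> s \<in> ?E N (g + \<gamma>)" for \<gamma> s
    proof -
      have "(\<exists>k\<le>Suc N. c \<le> h (g + walk (case_nat \<gamma> s) k)) \<longleftrightarrow>
            (\<exists>k\<le>N. c \<le> h (g + walk (case_nat \<gamma> s) (Suc k)))"
        using False by (metis Suc_le_mono add.right_neutral not0_implies_Suc walk.simps(1))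
      then show ?thesis by (simp add: walk_case_nat add.assoc del: walk.simps)
    qed
    have "emeasure S (?E (Suc N) g) = emeasure (distr (\<mu> \<Otimes>\<^sub>M S) S ?f) (?E (Suc N) g)"
      by (simp only: PiM_iter)
    also have "\<dots> = emeasure (\<mu> \<Otimes>\<^sub>M S) (?f -` ?E (Suc N) g \<inter> space (\<mu> \<Otimes>\<^sub>M S))"
      by (rule emeasure_distr[OF measurable_cons E])
    also have "\<dots> = (\<integral>\<^sup>+\<gamma>. emeasure S (?E N (g + \<gamma>)) \<partial>\<mu>)"
    proof (subst P.emeasure_pair_measure_alt)
      show "?f -` ?E (Suc N) g \<inter> space (\<mu> \<Otimes>\<^sub>M S) \<in> sets (\<mu> \<Otimes>\<^sub>M S)"
        by (rule measurable_sets[OF measurable_cons E])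
      have "Pair \<gamma> -` (?f -` ?E (Suc N) g \<inter> space (\<mu> \<Otimes>\<^sub>M S)) = ?E N (g + \<gamma>)" for \<gamma>
        using * by (auto simp: space_pair_measure space_path space_step)
      then show "(\<integral>\<^sup>+\<gamma>. emeasure S (Pair \<gamma> -` (?f -` ?E (Suc N) g \<inter> space (\<mu> \<Otimes>\<^sub>M S))) \<partial>\<mu>) =
        (\<integral>\<^sup>+\<gamma>. emeasure S (?E N (g + \<gamma>)) \<partial>\<mu>)" by simp
    qed
    also have "\<dots> \<le> (\<integral>\<^sup>+\<gamma>. ennreal (h (g + \<gamma>) / c) \<partial>\<mu>)"
      by (intro nn_integral_mono Suc.IH)
    also have "\<dots> = ennreal (h g / c)"
      using h01 \<open>c > 0\<close> by (subst nn_integral_eq_integral) (auto simp: mean intro!: integrable_divide_zero integrable_shift)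
    finally show ?thesis .
  qed
qed


lemma maximal_inequality:
  assumes h: "unit_harmonic h" and c: "c > 0"
  shows "emeasure S {s. \<exists>k. c \<le> h (g + walk s k)} \<le> ennreal (h g / c)"
proof -
  have [measurable]: "h \<in> borel_measurable borel"
    using h by (simp add: unit_harmonic_def)
  let ?E = "\<lambda>N. {s \<in> space S. \<exists>k\<le>N. c \<le> h (g + walk s k)}"
  have "emeasure S (\<Union>N. ?E N) = (SUP N. emeasure S (?E N))"
  proof (rule SUP_emeasure_incseq[symmetric])
    show "range ?E \<subseteq> sets S" by (intro image_subsetI) measurable
    show "incseq ?E" by (intro monoI) (auto intro: order_trans)
  qed
  also have "\<dots> \<le> ennreal (h g / c)"
    using maximal_inequality_finite[OF h c] by (intro SUP_least) (simp add: space_path)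
  also have "(\<Union>N. ?E N) = {s. \<exists>k. c \<le> h (g + walk s k)}"
    by (auto simp: space_path)
  finally show ?thesis .
qed

section \<open>Zero-one limits along the walk\<close>

text \<open>Cut the path at time \<open>n\<close>. Given the position at that time, with value
  \<open>u\<close> of \<open>h\<close>, the maximal inequality bounds the chance of a visit to level
  \<open>c\<close> from then on by \<open>u / c\<close> for \<open>h\<close> and by
  \<open>(1 - u) / c\<close> for \<open>1 - h\<close>; both visits occur with at most the smaller
  chance.\<close>

lemma late_oscillation_bound:
  assumes h: "unit_harmonic h" and c: "c > 0"
  shows "emeasure S {s. (\<exists>k\<ge>n. c \<le> h (walk s k)) \<and> (\<exists>k\<ge>n. c \<le> 1 - h (walk s k))}
    \<le> ennreal (2 / c * (\<integral>s. h (walk s n) * (1 - h (walk s n)) \<partial>S))"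
proof -
  have m [measurable]: "h \<in> borel_measurable borel" and h01: "\<And>g. h g \<in> {0..1}"
    using h by (auto simp: unit_harmonic_def)
  let ?B = "{s. (\<exists>k\<ge>n. c \<le> h (walk s k)) \<and> (\<exists>k\<ge>n. c \<le> 1 - h (walk s k))}"
  let ?f = "\<lambda>(s, t). comb_seq n s t"
  have B: "?B \<in> sets S"
  proof -
    have "{s\<in>space S. (\<exists>k\<ge>n. c \<le> h (walk s k)) \<and> (\<exists>k\<ge>n. c \<le> 1 - h (walk s k))} \<in> sets S"
      by measurable
    then show ?thesis by (simp add: space_path)
  qed
  have "emeasure S ?B = emeasure (distr (S \<Otimes>\<^sub>M S) S ?f) ?B"
    by (simp only: PiM_comb_seq)
  also have "\<dots> = emeasure (S \<Otimes>\<^sub>M S) (?f -` ?B \<inter> space (S \<Otimes>\<^sub>M S))"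
    by (rule emeasure_distr[OF measurable_comb_seq B])
  also have "\<dots> = (\<integral>\<^sup>+s. emeasure S (Pair s -` (?f -` ?B \<inter> space (S \<Otimes>\<^sub>M S))) \<partial>S)"
    by (intro P.emeasure_pair_measure_alt measurable_sets[OF measurable_comb_seq B])
  also have "\<dots> \<le> (\<integral>\<^sup>+s. ennreal (2 / c * (h (walk s n) * (1 - h (walk s n)))) \<partial>S)"
  proof (rule nn_integral_mono)
    fix s
    define u where "u = h (walk s n)"
    have sub1: "Pair s -` (?f -` ?B \<inter> space (S \<Otimes>\<^sub>M S)) \<subseteq> {t. \<exists>k. c \<le> h (walk s n + walk t k)}"
      by (auto simp: le_iff_add walk_comb_seq)
    have sub2: "Pair s -` (?f -` ?B \<inter> space (S \<Otimes>\<^sub>M S)) \<subseteq> {t. \<exists>k. c \<le> 1 - h (walk s n + walk t k)}"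
      by (auto simp: le_iff_add walk_comb_seq)
    have ms [measurable]: "{t. \<exists>k. c \<le> h (g + walk t k)} \<in> sets S"
        "{t. \<exists>k. c \<le> 1 - h (g + walk t k)} \<in> sets S" for g
    proof -
      have "{t \<in> space S. \<exists>k. c \<le> h (g + walk t k)} \<in> sets S"
        "{t \<in> space S. \<exists>k. c \<le> 1 - h (g + walk t k)} \<in> sets S" by measurable
      then show "{t. \<exists>k. c \<le> h (g + walk t k)} \<in> sets S"
        "{t. \<exists>k. c \<le> 1 - h (g + walk t k)} \<in> sets S" by (simp_all add: space_path)
    qed
    have "emeasure S (Pair s -` (?f -` ?B \<inter> space (S \<Otimes>\<^sub>M S))) \<le> ennreal (min u (1 - u) / c)"
    proof (cases "u \<le> 1 - u")
      case True
      then show ?thesis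
        using order_trans[OF emeasure_mono[OF sub1 ms(1)] maximal_inequality[OF h c]]
        by (simp add: u_def min_absorb1)
    next
      case False
      then show ?thesis
        using order_trans[OF emeasure_mono[OF sub2 ms(2)] maximal_inequality[OF unit_harmonic_compl[OF h] c]]
        by (simp add: u_def min_absorb2)
    qed
    also have "\<dots> \<le> ennreal (2 / c * (u * (1 - u)))"
    proof (rule ennreal_leI)
      have "0 \<le> u" "u \<le> 1" using h01 by (auto simp: u_def)
      \<comment> \<open>The larger of \<open>u\<close> and \<open>1 - u\<close> is at least
        \<open>1/2\<close>.\<close>
      have "min u (1 - u) \<le> 2 * (u * (1 - u))"
      proof (cases "u \<le> 1 - u")
        case True
        have "0 \<le> u * (1 - 2 * u)" using True \<open>0 \<le> u\<close> by simp
        then show ?thesis using True by (simp add: algebra_simps)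
      next
        case False
        have "0 \<le> (1 - u) * (2 * u - 1)" using False \<open>u \<le> 1\<close> by simp
        then show ?thesis using False by (simp add: algebra_simps)
      qed
      then show "min u (1 - u) / c \<le> 2 / c * (u * (1 - u))"
        using c by (simp add: field_simps)
    qed
    finally show "emeasure S (Pair s -` (?f -` ?B \<inter> space (S \<Otimes>\<^sub>M S)))
      \<le> ennreal (2 / c * (h (walk s n) * (1 - h (walk s n))))"
      by (simp add: u_def)
  qed
  also have "\<dots> = ennreal (\<integral>s. 2 / c * (h (walk s n) * (1 - h (walk s n))) \<partial>S)"
  proof (rule nn_integral_eq_integral)
    have "\<bar>h g * (1 - h g)\<bar> \<le> 1" for g
      using h01[of g] by (auto simp: abs_mult intro: mult_le_one)
    then have "integrable S (\<lambda>s. h (walk s n) * (1 - h (walk s n)))"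
      by (intro P.integrable_const_bound[where B=1]) auto
    then show "integrable S (\<lambda>s. 2 / c * (h (walk s n) * (1 - h (walk s n))))" by simp
    show "AE s in S. 0 \<le> 2 / c * (h (walk s n) * (1 - h (walk s n)))"
      using h01 c by auto
  qed
  finally show ?thesis by simp
qed

text \<open>Paths on which both \<open>h\<close> and \<open>1 - h\<close> reach level
  \<open>c\<close> at arbitrarily late times lie in every event of
  \<open>late_oscillation_bound\<close>, whose bounds tend to \<open>0\<close>. So almost surely
  \<open>h\<close> or \<open>1 - h\<close> eventually stays below \<open>c\<close>; running through
  the thresholds \<open>1/(m+1)\<close> yields a limit.\<close>

lemma AE_zero_one_limit:
  assumes h: "unit_harmonic h"
    and lim: "(\<lambda>n. \<integral>s. h (walk s n) * (1 - h (walk s n)) \<partial>S) \<longlonglongrightarrow> 0"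
  shows "AE s in S. (\<lambda>n. h (walk s n)) \<longlonglongrightarrow> 0 \<or> (\<lambda>n. h (walk s n)) \<longlonglongrightarrow> 1"
proof -
  have m [measurable]: "h \<in> borel_measurable borel" and h01: "\<And>g. h g \<in> {0..1}"
    using h by (auto simp: unit_harmonic_def)
  have "AE s in S. \<exists>n. (\<forall>k\<ge>n. h (walk s k) < c) \<or> (\<forall>k\<ge>n. 1 - h (walk s k) < c)" if c: "c > 0" for c
  proof -
    let ?B = "\<lambda>n. {s \<in> space S. (\<exists>k\<ge>n. c \<le> h (walk s k)) \<and> (\<exists>k\<ge>n. c \<le> 1 - h (walk s k))}"
    have Bm: "?B n \<in> sets S" for n by measurable
    have "emeasure S (\<Inter>n. ?B n) \<le> 0"
    proof (rule LIMSEQ_le_const)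
      show "(\<lambda>n. ennreal (2 / c * (\<integral>s. h (walk s n) * (1 - h (walk s n)) \<partial>S))) \<longlonglongrightarrow> 0"
        using tendsto_ennrealI[OF tendsto_mult_right_zero[OF lim, of "2 / c"]] by simp
      have "emeasure S (\<Inter>n. ?B n) \<le> emeasure S (?B n)" for n
        using Bm by (intro emeasure_mono) auto
      then show "\<exists>N. \<forall>n\<ge>N. emeasure S (\<Inter>n. ?B n)
          \<le> ennreal (2 / c * (\<integral>s. h (walk s n) * (1 - h (walk s n)) \<partial>S))"
        using late_oscillation_bound[OF h c] by (auto simp: space_path intro: order_trans)
    qed
    then have "(\<Inter>n. ?B n) \<in> null_sets S"
      using Bm by (intro null_setsI sets.countable_INT) auto
    then show ?thesis
      by (rule AE_I') (auto simp: space_path not_less)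
  qed
  then have "AE s in S. \<forall>m. \<exists>n. (\<forall>k\<ge>n. h (walk s k) < inverse (real (Suc m))) \<or>
      (\<forall>k\<ge>n. 1 - h (walk s k) < inverse (real (Suc m)))"
    by (subst AE_all_countable) auto
  then show ?thesis
  proof eventually_elim
    case (elim s)
    show ?case
    proof (cases "\<forall>m. \<exists>n. \<forall>k\<ge>n. h (walk s k) < inverse (real (Suc m))")
      case True
      have "(\<lambda>n. h (walk s n)) \<longlonglongrightarrow> 0"
      proof (rule LIMSEQ_I)
        fix r :: real assume "0 < r"
        then obtain m where "inverse (real (Suc m)) < r" using reals_Archimedean by blast
        then show "\<exists>no. \<forall>n\<ge>no. norm (h (walk s n) - 0) < r"
          using True h01 by (auto simp: abs_of_nonneg) (meson order_less_trans)
      qed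
      then show ?thesis ..
    next
      case False
      then obtain m0 where m0: "\<And>n. \<exists>k\<ge>n. \<not> h (walk s k) < inverse (real (Suc m0))" by blast
      \<comment> \<open>Once \<open>h\<close> fails to stay below the threshold of index
        \<open>m0\<close>, it fails for all smaller thresholds, which leaves the alternative for
        \<open>1 - h\<close>.\<close>
      have *: "\<exists>n. \<forall>k\<ge>n. 1 - h (walk s k) < inverse (real (Suc m))" if "m \<ge> m0" for m
      proof -
        have "inverse (real (Suc m)) \<le> inverse (real (Suc m0))" using that by simp
        then have "\<not> (\<forall>k\<ge>n. h (walk s k) < inverse (real (Suc m)))" for n
          using m0[of n] by (meson order_less_le_trans)
        then show ?thesis using elim by blast
      qed
      have "(\<lambda>n. h (walk s n)) \<longlonglongrightarrow> 1"
      proof (rule LIMSEQ_I)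
        fix r :: real assume "0 < r"
        then obtain m where m: "inverse (real (Suc m)) < r" using reals_Archimedean by blast
        have "inverse (real (Suc (max m m0))) \<le> inverse (real (Suc m))" by simp
        then have "inverse (real (Suc (max m m0))) < r" using m by linarith
        moreover obtain n where "\<forall>k\<ge>n. 1 - h (walk s k) < inverse (real (Suc (max m m0)))"
          using *[of "max m m0"] by auto
        moreover have "norm (h g - 1) = 1 - h g" for g using h01[of g] by simp
        ultimately show "\<exists>no. \<forall>n\<ge>no. norm (h (walk s n) - 1) < r"
          by (metis order_less_trans)
      qed
      then show ?thesis ..
    qed
  qed
qed

text \<open>Harmonicity keeps the mean of \<open>h (walk s n)\<close> equal to \<open>h 0\<close>;
  dominated convergence passes this to the limit, which is almost surely the indicator of the
  event.\<close>

lemma mean_limit_measure: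
  assumes h: "unit_harmonic h"
    and lim: "AE s in S. (\<lambda>n. h (walk s n)) \<longlonglongrightarrow> 0 \<or> (\<lambda>n. h (walk s n)) \<longlonglongrightarrow> 1"
  shows "measure S {s. (\<lambda>n. h (walk s n)) \<longlonglongrightarrow> 1} = h 0"
proof -
  have m [measurable]: "h \<in> borel_measurable borel" and h01: "\<And>g. h g \<in> {0..1}"
    using h by (auto simp: unit_harmonic_def)
  let ?L = "{s \<in> space S. (\<lambda>n. h (walk s n)) \<longlonglongrightarrow> 1}"
  have L [measurable]: "?L \<in> sets S" by measurable
  have "(\<lambda>n. \<integral>s. h (walk s n) \<partial>S) \<longlonglongrightarrow> (\<integral>s. indicator ?L s \<partial>S)"
  proof (rule integral_dominated_convergence[where w="\<lambda>_. 1"])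
    show "AE s in S. (\<lambda>n. h (walk s n)) \<longlonglongrightarrow> indicator ?L s"
      using lim
    proof eventually_elim
      case (elim s)
      then show ?case
        by (cases "(\<lambda>n. h (walk s n)) \<longlonglongrightarrow> 1") (auto simp: space_path)
    qed
    show "AE s in S. norm (h (walk s n)) \<le> 1" for n using h01 by simp
  qed (use L in simp_all)
  moreover have "(\<integral>s. h (walk s n) \<partial>S) = h 0" for n
    using expectation_walk[OF m h01, of 0 n] transition_harmonic[OF h, of n 0] by simp
  ultimately have "h 0 = (\<integral>s. indicator ?L s \<partial>S)"
    by (simp add: LIMSEQ_const_iff)
  then show ?thesis by (simp add: space_path)
qed

section \<open>Second moments along the walk\<close>

text \<open>Since the variance of one step is nonnegative, the second moments increase in
  \<open>n\<close>; their limit is harmonic because the one-step average of the \<open>n\<close>-th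
  moment is the next one. The bounds come from \<open>h\<^sup>2 \<le> h\<close> and
  \<open>(1 - h)\<^sup>2 \<ge> 0\<close>.\<close>

lemma square_limit_harmonic:
  assumes h: "unit_harmonic h"
  obtains q where "unit_harmonic q" "\<And>g. (\<lambda>n. transition n (\<lambda>x. (h x)\<^sup>2) g) \<longlonglongrightarrow> q g"
    "\<And>g. q g \<le> h g" "\<And>g. 2 * h g - 1 \<le> q g"
proof -
  let ?Q = "\<lambda>n. transition n (\<lambda>x. (h x)\<^sup>2)"
  have m [measurable]: "h \<in> borel_measurable borel" and h01: "\<And>g. h g \<in> {0..1}"
    and mean: "\<And>g. (\<integral>\<gamma>. h (g + \<gamma>) \<partial>\<mu>) = h g"
    using h by (auto simp: unit_harmonic_def)
  have m2 [measurable]: "(\<lambda>x. (h x)\<^sup>2) \<in> borel_measurable borel" by measurable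
  have sq01: "(h g)\<^sup>2 \<in> {0..1}" for g using h01[of g] by (auto simp: power_le_one)
  have Qm [measurable]: "?Q n \<in> borel_measurable borel" for n
    by (rule transition_measurable[OF m2 sq01])
  have Q01: "?Q n g \<in> {0..1}" for n g
    by (rule transition_unit_interval[OF m2 sq01])
  have int: "integrable \<mu> (\<lambda>\<gamma>. ?Q n (g + \<gamma>))" for n g
    by (rule integrable_shift[OF Qm Q01])
  have inth: "integrable \<mu> (\<lambda>\<gamma>. h (g + \<gamma>))" for g
    by (rule integrable_shift[OF m h01])
  have inc: "?Q n g \<le> ?Q (Suc n) g" for n g
  proof (induction n arbitrary: g)
    case 0
    have "0 \<le> (\<integral>\<gamma>. (h (g + \<gamma>) - h g)\<^sup>2 \<partial>\<mu>)" by simp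
    also have "\<dots> = (\<integral>\<gamma>. (h (g + \<gamma>))\<^sup>2 - 2 * h g * h (g + \<gamma>) + (h g)\<^sup>2 \<partial>\<mu>)"
      by (intro Bochner_Integration.integral_cong) (auto simp: power2_eq_square algebra_simps)
    also have "\<dots> = (\<integral>\<gamma>. (h (g + \<gamma>))\<^sup>2 \<partial>\<mu>) - (h g)\<^sup>2"
      using int[of 0 g] inth[of g] by (simp add: mean M.prob_space power2_eq_square)
    finally show ?case by simp
  next
    case (Suc n)
    then show ?case
      using integral_mono[OF int int, of n g "Suc n" g] by simp
  qed
  have "\<exists>L. (\<lambda>n. ?Q n g) \<longlonglongrightarrow> L" for g
  proof -
    have "incseq (\<lambda>n. ?Q n g)" using inc by (rule incseq_SucI)
    moreover have "\<forall>n. ?Q n g \<le> 1" using Q01 by simp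
    ultimately show ?thesis by (metis incseq_convergent)
  qed
  then obtain q where lim: "\<And>g. (\<lambda>n. ?Q n g) \<longlonglongrightarrow> q g" by metis
  have qm [measurable]: "q \<in> borel_measurable borel"
    by (rule borel_measurable_LIMSEQ_real[OF lim Qm])
  have q01: "q g \<in> {0..1}" for g
    using LIMSEQ_le_const[OF lim, of 0 g] LIMSEQ_le_const2[OF lim, of g 1] Q01 by auto
  have "(\<integral>\<gamma>. q (g + \<gamma>) \<partial>\<mu>) = q g" for g
  proof -
    have "(\<lambda>n. \<integral>\<gamma>. ?Q n (g + \<gamma>) \<partial>\<mu>) \<longlonglongrightarrow> (\<integral>\<gamma>. q (g + \<gamma>) \<partial>\<mu>)"
      using Q01 by (intro integral_dominated_convergence[where w="\<lambda>_. 1"]) (auto simp: lim)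
    moreover have "(\<lambda>n. ?Q (Suc n) g) \<longlonglongrightarrow> q g" using lim by (rule LIMSEQ_Suc)
    ultimately show ?thesis by (simp add: LIMSEQ_unique)
  qed
  then have qh: "unit_harmonic q" using qm q01 by (auto simp: unit_harmonic_def)
  have le: "?Q n g \<le> h g" for n g
  proof (induction n arbitrary: g)
    case 0
    show ?case using h01[of g] by (simp add: power2_eq_square mult_left_le)
  next
    case (Suc n)
    then show ?case using integral_mono[OF int inth, of n g g] by (simp add: mean)
  qed
  have ge: "2 * h g - 1 \<le> ?Q n g" for n g
  proof (induction n)
    case 0
    have "0 \<le> (1 - h g)\<^sup>2" by simp
    then show ?case by (simp add: power2_eq_square algebra_simps)
  next
    case (Suc n)
    then show ?case using inc[of n g] by linarith
  qed
  show thesis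
    by (rule that[OF qh lim LIMSEQ_le_const2[OF lim] LIMSEQ_le_const[OF lim]]) (use le ge in auto)
qed

end

section \<open>Transforms of indicator functions\<close>

lemma g_space_measurable_act:
  assumes "g_space X act"
  shows "act g \<in> X \<rightarrow>\<^sub>M X"
proof -
  have "(\<lambda>(g, x). act g x) \<in> borel \<Otimes>\<^sub>M X \<rightarrow>\<^sub>M X"
    using assms by (simp add: g_space_def)
  from measurable_compose[OF measurable_Pair1' this, of g] show ?thesis by simp
qed

section \<open>Linearity, norm and order under the Poisson transform\<close>

lemma linf_const: "(\<lambda>_. c) \<in> linf \<nu>"
  by (auto simp: linf_def)

lemma linf_add:
  assumes "f \<in> linf \<nu>" "f' \<in> linf \<nu>"
  shows "(\<lambda>x. f x + f' x) \<in> linf \<nu>"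
proof -
  obtain C C' where "AE x in \<nu>. cmod (f x) \<le> C" "AE x in \<nu>. cmod (f' x) \<le> C'"
    using assms by (auto simp: linf_def)
  then have "AE x in \<nu>. cmod (f x + f' x) \<le> C + C'"
    by eventually_elim (meson add_mono norm_triangle_ineq order_trans)
  then show ?thesis using assms by (auto simp: linf_def)
qed

lemma linf_mult:
  assumes "f \<in> linf \<nu>"
  shows "(\<lambda>x. c * f x) \<in> linf \<nu>"
proof -
  obtain C where "AE x in \<nu>. cmod (f x) \<le> C" using assms by (auto simp: linf_def)
  then have "AE x in \<nu>. cmod (c * f x) \<le> cmod c * C"
    by eventually_elim (simp add: norm_mult mult_left_mono)
  then show ?thesis using assms by (auto simp: linf_def)
qed

text \<open>The unit interval is the intersection of the closed discs with centre \<open>1/2 + i t\<close>, \<open>t\<close> an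
  integer, that have \<open>0\<close> and \<open>1\<close> on their boundary.\<close>

lemma complex_unit_interval_if_in_discs:
  assumes "\<And>t::int. cmod (z - Complex (1/2) (of_int t)) \<le> sqrt (1/4 + (of_int t)\<^sup>2)"
  shows "Im z = 0 \<and> Re z \<in> {0..1}"
proof -
  \<comment> \<open>The square of \<open>t\<close> cancels, which leaves a bound affine in
    \<open>t\<close> for every integer; large \<open>t\<close> of either sign then force
    \<open>Im z = 0\<close>, and \<open>t = 0\<close> bounds the real part.\<close>
  have *: "(Re z - 1/2)\<^sup>2 + (Im z)\<^sup>2 - 2 * Im z * of_int t \<le> 1/4" for t :: int
  proof -
    have "(Re z - 1/2)\<^sup>2 + (Im z - of_int t)\<^sup>2 \<le> 1/4 + (of_int t)\<^sup>2"
      using assms[of t] by (simp add: cmod_def)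
    then show ?thesis by (simp add: power2_eq_square algebra_simps)
  qed
  have "Im z = 0"
  proof (rule ccontr)
    assume ne: "Im z \<noteq> 0"
    then obtain N :: nat where N: "1/4 < real N * (2 * \<bar>Im z\<bar>)"
      using reals_Archimedean3[of "2 * \<bar>Im z\<bar>"] by (metis zero_less_abs_iff zero_less_mult_iff zero_less_numeral)
    show False
      using *[of "int N"] *[of "- int N"] N zero_le_power2[of "Re z - 1/2"] zero_le_power2[of "Im z"]
      by (cases "Im z > 0") (auto simp: mult.commute)
  qed
  moreover have "\<bar>Re z - 1/2\<bar> \<le> \<bar>1/2\<bar>"
    unfolding abs_le_square_iff using *[of 0] \<open>Im z = 0\<close> by (simp add: power_divide)
  then have "0 \<le> Re z \<and> Re z \<le> 1" by linarith
  ultimately show ?thesis by simp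
qed

lemma poisson_transform_const:
  assumes "prob_space \<nu>"
  shows "poisson_transform \<nu> act (\<lambda>_. c) g = c"
  using assms by (simp add: poisson_transform_def prob_space.prob_space)

context
  fixes \<mu> :: "'g::topological_group_add measure" and \<nu> :: "'b measure" and act
  assumes pb: "poisson_boundary \<mu> \<nu> act"
begin

lemma poisson_prob_space: "prob_space \<nu>"
  using pb unfolding poisson_boundary_def prob_g_space_def by blast

lemma poisson_transform_bounded_harmonic:
  assumes "f \<in> linf \<nu>"
  shows "poisson_transform \<nu> act f \<in> bounded_harmonic \<mu>"
  using pb assms unfolding poisson_boundary_def by blast

lemma poisson_transform_surj:
  assumes "h \<in> bounded_harmonic \<mu>"
  shows "\<exists>f\<in>linf \<nu>. poisson_transform \<nu> act f = h"
  using pb assms unfolding poisson_boundary_def by blast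

lemma poisson_transform_cong:
  assumes "f \<in> linf \<nu>" "f' \<in> linf \<nu>" "AE x in \<nu>. f x = f' x"
  shows "poisson_transform \<nu> act f = poisson_transform \<nu> act f'"
  using pb assms unfolding poisson_boundary_def by blast

lemma poisson_transform_add:
  assumes "f \<in> linf \<nu>" "f' \<in> linf \<nu>"
  shows "poisson_transform \<nu> act (\<lambda>x. f x + f' x) g =
    poisson_transform \<nu> act f g + poisson_transform \<nu> act f' g"
  using pb assms unfolding poisson_boundary_def by blast

lemma poisson_transform_mult:
  assumes "f \<in> linf \<nu>"
  shows "poisson_transform \<nu> act (\<lambda>x. c * f x) g = c * poisson_transform \<nu> act f g"
  using pb assms unfolding poisson_boundary_def by blast

lemma poisson_transform_norm_bound:
  assumes f: "f \<in> linf \<nu>" and le: "\<And>g. cmod (poisson_transform \<nu> act f g) \<le> C"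
  shows "AE x in \<nu>. cmod (f x) \<le> C"
proof -
  have "esssup \<nu> (\<lambda>x. ereal (cmod (f x))) = (SUP g. ereal (cmod (poisson_transform \<nu> act f g)))"
    using pb f unfolding poisson_boundary_def by metis
  also have "\<dots> \<le> ereal C" using le by (intro SUP_least) simp
  finally have "esssup \<nu> (\<lambda>x. ereal (cmod (f x))) \<le> ereal C" .
  then show ?thesis
    using esssup_AE[of "\<lambda>x. ereal (cmod (f x))" \<nu>]
    by (auto elim!: eventually_mono dest: order_trans)
qed

text \<open>The isometry speaks of norms only. Lying in a disc is a norm bound after subtracting the
  centre, and the transform preserves constants, so each disc condition passes from the transform to
  \<open>f\<close>. Integer \<open>t\<close> give countably many conditions, hence one exceptional
  null set.\<close>

lemma poisson_transform_reflects_unit_interval: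
  assumes f: "f \<in> linf \<nu>"
    and r: "\<And>g. poisson_transform \<nu> act f g = complex_of_real (r g)" "\<And>g. r g \<in> {0..1}"
  shows "AE x in \<nu>. Im (f x) = 0 \<and> Re (f x) \<in> {0..1}"
proof -
  have "AE x in \<nu>. cmod (f x - Complex (1/2) (of_int t)) \<le> sqrt (1/4 + (of_int t)\<^sup>2)" for t :: int
  proof -
    let ?c = "- Complex (1/2) (of_int t)"
    have "AE x in \<nu>. cmod (f x + ?c) \<le> sqrt (1/4 + (of_int t)\<^sup>2)"
    proof (rule poisson_transform_norm_bound[OF linf_add[OF f linf_const]])
      fix g
      have "poisson_transform \<nu> act (\<lambda>x. f x + ?c) g = complex_of_real (r g) + ?c"
        by (simp only: poisson_transform_add[OF f linf_const] r(1)
            poisson_transform_const[OF poisson_prob_space])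
      moreover have "(r g - 1/2)\<^sup>2 \<le> (1/2)\<^sup>2"
        using r(2)[of g] by (intro abs_le_square_iff[THEN iffD1]) (simp add: abs_if field_simps)
      ultimately show "cmod (poisson_transform \<nu> act (\<lambda>x. f x + ?c) g) \<le> sqrt (1/4 + (of_int t)\<^sup>2)"
        by (simp add: cmod_def power2_eq_square)
    qed
    then show ?thesis by simp
  qed
  then have "AE x in \<nu>. \<forall>t::int. cmod (f x - Complex (1/2) (of_int t)) \<le> sqrt (1/4 + (of_int t)\<^sup>2)"
    by (subst AE_all_countable) blast
  then show ?thesis
  proof eventually_elim
    case (elim x)
    show ?case by (rule complex_unit_interval_if_in_discs) (rule elim[rule_format])
  qed
qed

end

section \<open>Indicator functions and vanishing variance\<close>

lemma (in random_walk) bounded_harmonic_of_real_iff: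
  assumes "\<And>g. h g \<in> {0..1}"
  shows "(\<lambda>g. complex_of_real (h g)) \<in> bounded_harmonic \<mu> \<longleftrightarrow> unit_harmonic h"
proof -
  have "bounded (range (\<lambda>g. complex_of_real (h g)))"
    using assms by (auto simp: bounded_iff intro!: exI[of _ 1])
  moreover have "(\<lambda>g. complex_of_real (h g)) \<in> borel_measurable borel \<longleftrightarrow> h \<in> borel_measurable borel"
    by (auto simp: borel_measurable_complex_iff)
  moreover have "complex_of_real (h g) = (\<integral>\<gamma>. complex_of_real (h (g + \<gamma>)) \<partial>\<mu>) \<longleftrightarrow>
      (\<integral>\<gamma>. h (g + \<gamma>) \<partial>\<mu>) = h g" for g
    by (auto simp del: of_real_eq_iff simp: of_real_eq_iff[symmetric, where 'a=complex])
  moreover have "integrable \<mu> (\<lambda>\<gamma>. complex_of_real (h (g + \<gamma>)))" if "h \<in> borel_measurable borel" for g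
    using integrable_shift[OF that assms] by simp
  ultimately show ?thesis
    using assms unfolding bounded_harmonic_def harmonic_def unit_harmonic_def by auto
qed

text \<open>The limit \<open>q\<close> of the second moments of \<open>h\<close> along the walk is harmonic and satisfies
  \<open>max 0 (2 h - 1) \<le> q \<le> h\<close>. The transform is an order isomorphism, and an indicator function
  \<open>f\<close> is the only function between \<open>max 0 (2 f - 1)\<close> and \<open>f\<close>; hence \<open>q = h\<close>.\<close>

lemma (in random_walk) variance_tendsto_0_indicator:
  assumes pb: "poisson_boundary \<mu> \<nu> act"
    and D: "D \<in> sets \<nu>"
    and h: "\<And>g. poisson_transform \<nu> act (\<lambda>x. complex_of_real (indicator D x)) g = complex_of_real (h g)"
    and h01: "\<And>g. h g \<in> {0..1}"
  shows "unit_harmonic h" "(\<lambda>n. \<integral>s. h (walk s n) * (1 - h (walk s n)) \<partial>S) \<longlonglongrightarrow> 0"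
proof -
  let ?f = "\<lambda>x. complex_of_real (indicator D x)"
  have f: "?f \<in> linf \<nu>"
    using D by (auto simp: linf_def indicator_def intro!: exI[of _ 1])
  have "poisson_transform \<nu> act ?f = (\<lambda>g. complex_of_real (h g))" using h by auto
  then have "(\<lambda>g. complex_of_real (h g)) \<in> bounded_harmonic \<mu>"
    using poisson_transform_bounded_harmonic[OF pb f] by simp
  then show uh: "unit_harmonic h"
    using bounded_harmonic_of_real_iff h01 by blast
  obtain q where q: "unit_harmonic q" and lim: "\<And>g. (\<lambda>n. transition n (\<lambda>x. (h x)\<^sup>2) g) \<longlonglongrightarrow> q g"
    and qle: "\<And>g. q g \<le> h g" and qge: "\<And>g. 2 * h g - 1 \<le> q g"
    using square_limit_harmonic[OF uh] by blast
  have q01: "\<And>g. q g \<in> {0..1}" using q by (simp add: unit_harmonic_def)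
  have "(\<lambda>g. complex_of_real (q g)) \<in> bounded_harmonic \<mu>"
    using bounded_harmonic_of_real_iff[of q] q01 q by blast
  then obtain e where e: "e \<in> linf \<nu>" and Pe: "poisson_transform \<nu> act e = (\<lambda>g. complex_of_real (q g))"
    using poisson_transform_surj[OF pb] by blast
  have a1: "AE x in \<nu>. Im (e x) = 0 \<and> Re (e x) \<in> {0..1}"
    by (rule poisson_transform_reflects_unit_interval[OF pb e, where r=q]) (use Pe q01 in auto)
  \<comment> \<open>Order comparisons are phrased as values in the unit interval: here
    \<open>e \<le> ?f\<close> comes from \<open>q \<le> h\<close>, and in \<open>a3\<close> the
    bound \<open>2 * ?f - 1 \<le> e\<close> comes from \<open>2 * h - 1 \<le> q\<close>.\<close>
  have a2: "AE x in \<nu>. Im (?f x + (-1) * e x) = 0 \<and> Re (?f x + (-1) * e x) \<in> {0..1}"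
  proof (rule poisson_transform_reflects_unit_interval[OF pb linf_add[OF f linf_mult[OF e]], where r="\<lambda>g. h g - q g"])
    show "poisson_transform \<nu> act (\<lambda>x. ?f x + (-1) * e x) g = complex_of_real (h g - q g)" for g
      unfolding poisson_transform_add[OF pb f linf_mult[OF e]] poisson_transform_mult[OF pb e] h Pe by simp
    show "h g - q g \<in> {0..1}" for g using qle[of g] q01[of g] h01[of g] by auto
  qed
  have a3: "AE x in \<nu>. Im (e x + ((-2) * ?f x + 1)) = 0 \<and> Re (e x + ((-2) * ?f x + 1)) \<in> {0..1}"
  proof (rule poisson_transform_reflects_unit_interval[OF pb linf_add[OF e linf_add[OF linf_mult[OF f] linf_const]],
        where r="\<lambda>g. q g - 2 * h g + 1"])
    show "poisson_transform \<nu> act (\<lambda>x. e x + ((-2) * ?f x + 1)) g = complex_of_real (q g - 2 * h g + 1)" for g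
      unfolding poisson_transform_add[OF pb e linf_add[OF linf_mult[OF f] linf_const]]
        poisson_transform_add[OF pb linf_mult[OF f] linf_const]
        poisson_transform_const[OF poisson_prob_space[OF pb]]
        poisson_transform_mult[OF pb f] h Pe by simp
    show "q g - 2 * h g + 1 \<in> {0..1}" for g using qge[of g] qle[of g] h01[of g] by auto
  qed
  \<comment> \<open>On \<open>D\<close>, \<open>a1\<close> and \<open>a3\<close> force
    \<open>e x = 1\<close>; off \<open>D\<close>, \<open>a1\<close> and \<open>a2\<close> force
    \<open>e x = 0\<close>.\<close>
  have "AE x in \<nu>. e x = ?f x"
    using a1 a2 a3
  proof eventually_elim
    case (elim x)
    then show ?case by (cases "x \<in> D") (auto simp: complex_eq_iff)
  qed
  then have "poisson_transform \<nu> act e = poisson_transform \<nu> act ?f"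
    by (rule poisson_transform_cong[OF pb e f])
  then have qh: "q g = h g" for g
    using h[of g] Pe by (metis of_real_eq_iff)
  have m [measurable]: "h \<in> borel_measurable borel"
    using uh by (auto simp: unit_harmonic_def)
  have sq01: "(h g)\<^sup>2 \<in> {0..1}" for g using h01[of g] by (auto simp: power_le_one)
  have "(\<integral>s. h (walk s n) * (1 - h (walk s n)) \<partial>S) = h 0 - transition n (\<lambda>x. (h x)\<^sup>2) 0" for n
  proof -
    have "integrable S (\<lambda>s. h (walk s n))" "integrable S (\<lambda>s. (h (walk s n))\<^sup>2)"
      using h01 sq01 by (auto intro!: P.integrable_const_bound[where B=1])
    then have "(\<integral>s. h (walk s n) - (h (walk s n))\<^sup>2 \<partial>S) = (\<integral>s. h (walk s n) \<partial>S) - (\<integral>s. (h (walk s n))\<^sup>2 \<partial>S)"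
      by simp
    also have "\<dots> = h 0 - transition n (\<lambda>x. (h x)\<^sup>2) 0"
      using expectation_walk[of h 0 n] expectation_walk[of "\<lambda>x. (h x)\<^sup>2" 0 n] h01 sq01
        transition_harmonic[OF uh, of n 0] by simp
    finally show ?thesis by (simp add: power2_eq_square algebra_simps)
  qed
  moreover have "(\<lambda>n. h 0 - transition n (\<lambda>x. (h x)\<^sup>2) 0) \<longlonglongrightarrow> h 0 - q 0"
    by (intro tendsto_intros lim)
  ultimately show "(\<lambda>n. \<integral>s. h (walk s n) * (1 - h (walk s n)) \<partial>S) \<longlonglongrightarrow> 0"
    by (simp add: qh)
qed

section \<open>Translates of the measure on a factor\<close>

text \<open>The mass of \<open>A\<close> under the translate of \<kappa> by \<open>g\<close>. The
  name anticipates that at \<open>g = 0\<close> it is the probability that the limit point of the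
  walk lies in \<open>A\<close>.\<close>

definition hit_prob :: "'x measure \<Rightarrow> ('g \<Rightarrow> 'x \<Rightarrow> 'x) \<Rightarrow> 'x set \<Rightarrow> 'g \<Rightarrow> real" where
  "hit_prob \<kappa> act A g = measure \<kappa> {x \<in> space \<kappa>. act g x \<in> A}"

text \<open>Change of variables along \<open>\<pi>\<close>. Equivariance holds almost everywhere for
  each fixed \<open>g\<close>, which is enough because the value at \<open>g\<close> is a single
  integral.\<close>

lemma poisson_transform_factor:
  assumes B: "prob_g_space \<nu> actB" and X: "prob_g_space \<kappa> actX"
    and \<pi>: "g_factor_map \<nu> actB \<kappa> actX \<pi>" and A [measurable]: "A \<in> sets \<kappa>"
  shows "poisson_transform \<nu> actB (\<lambda>b. complex_of_real (indicator (\<pi> -` A \<inter> space \<nu>) b)) g =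
    complex_of_real (hit_prob \<kappa> actX A g)"
proof -
  have [measurable]: "actB g \<in> \<nu> \<rightarrow>\<^sub>M \<nu>" "actX g \<in> \<kappa> \<rightarrow>\<^sub>M \<kappa>"
    using B X by (auto simp: prob_g_space_def intro: g_space_measurable_act)
  have [measurable]: "\<pi> \<in> \<nu> \<rightarrow>\<^sub>M \<kappa>" and law: "distr \<nu> \<kappa> \<pi> = \<kappa>"
    and eq: "AE b in \<nu>. \<pi> (actB g b) = actX g (\<pi> b)"
    using \<pi> by (auto simp: g_factor_map_def)
  have "poisson_transform \<nu> actB (\<lambda>b. complex_of_real (indicator (\<pi> -` A \<inter> space \<nu>) b)) g
      = complex_of_real (\<integral>b. indicator (\<pi> -` A \<inter> space \<nu>) (actB g b) \<partial>\<nu>)"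
    by (simp add: poisson_transform_def)
  also have "(\<integral>b. indicator (\<pi> -` A \<inter> space \<nu>) (actB g b) \<partial>\<nu> :: real) = (\<integral>b. indicator A (actX g (\<pi> b)) \<partial>\<nu>)"
  proof (rule integral_cong_AE)
    show "AE b in \<nu>. (indicator (\<pi> -` A \<inter> space \<nu>) (actB g b) :: real) = indicator A (actX g (\<pi> b))"
      using eq AE_space[of \<nu>]
    proof eventually_elim
      case (elim b)
      moreover have "actB g b \<in> space \<nu>"
        using measurable_space[OF \<open>actB g \<in> \<nu> \<rightarrow>\<^sub>M \<nu>\<close> elim(2)] .
      ultimately show ?case by (auto simp: indicator_def)
    qed
  qed measurable
  also have "\<dots> = (\<integral>x. indicator A (actX g x) \<partial>distr \<nu> \<kappa> \<pi>)"
    by (subst integral_distr) auto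
  also have "\<dots> = (\<integral>x. indicator {x \<in> space \<kappa>. actX g x \<in> A} x \<partial>\<kappa>)"
    unfolding law by (intro Bochner_Integration.integral_cong) (auto simp: indicator_def)
  also have "\<dots> = hit_prob \<kappa> actX A g" by (simp add: hit_prob_def Int_absorb2 subset_eq)
  finally show ?thesis .
qed

section \<open>The limit point of a path\<close>

lemma sets_borel_of_openin: "openin T U \<Longrightarrow> U \<in> sets (borel_of T)"
  unfolding borel_of_def by (subst sets_measure_of) (auto dest: openin_subset)

lemma space_borel_of: "space (borel_of T) = topspace T"
  by (auto simp: borel_of_def space_measure_of_conv)

section \<open>Concentration of the translated measures along a path\<close>

text \<open>All that the construction of the limit takes from the Poisson boundary: harmonicity and
  the zero-one limit of the functions \<open>hit_prob \<kappa> act A\<close>. The space on which the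
  transform lives no longer appears.\<close>

locale boundary_walk = random_walk \<mu>
  for \<mu> :: "'g::{topological_group_add, second_countable_topology} measure" +
  fixes \<kappa> :: "'x measure" and act :: "'g \<Rightarrow> 'x \<Rightarrow> 'x"
  assumes prob_g_space: "prob_g_space \<kappa> act"
    and harmonic_hit_prob: "\<And>A. A \<in> sets \<kappa> \<Longrightarrow> unit_harmonic (hit_prob \<kappa> act A)"
    and zero_one_hit_prob: "\<And>A. A \<in> sets \<kappa> \<Longrightarrow> AE s in S.
      (\<lambda>n. hit_prob \<kappa> act A (walk s n)) \<longlonglongrightarrow> 0 \<or> (\<lambda>n. hit_prob \<kappa> act A (walk s n)) \<longlonglongrightarrow> 1"
begin

sublocale X: prob_space \<kappa>
  using prob_g_space by (simp add: prob_g_space_def)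

lemma act_measurable [measurable]: "act g \<in> \<kappa> \<rightarrow>\<^sub>M \<kappa>"
  using prob_g_space by (simp add: prob_g_space_def g_space_measurable_act)

lemma hit_prob_0: "A \<in> sets \<kappa> \<Longrightarrow> hit_prob \<kappa> act A 0 = measure \<kappa> A"
proof -
  assume A: "A \<in> sets \<kappa>"
  have "{x \<in> space \<kappa>. act 0 x \<in> A} = A"
    using prob_g_space sets.sets_into_space[OF A] by (auto simp: prob_g_space_def g_space_def)
  then show ?thesis by (simp add: hit_prob_def)
qed

lemma hit_prob_mono:
  assumes [measurable]: "B \<in> sets \<kappa>" and "A \<subseteq> B"
  shows "hit_prob \<kappa> act A g \<le> hit_prob \<kappa> act B g"
  unfolding hit_prob_def by (rule X.finite_measure_mono) (use assms(2) in auto)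

lemma hit_prob_Diff:
  assumes [measurable]: "A \<in> sets \<kappa>"
  shows "hit_prob \<kappa> act (space \<kappa> - A) g = 1 - hit_prob \<kappa> act A g"
proof -
  have "{x \<in> space \<kappa>. act g x \<in> space \<kappa> - A} = space \<kappa> - {x \<in> space \<kappa>. act g x \<in> A}"
    using measurable_space[OF act_measurable] by blast
  then show ?thesis
    unfolding hit_prob_def by (simp add: X.prob_compl)
qed

text \<open>Union bound for the complements. It makes near-full mass stable under intersection, and
  it keeps two disjoint sets from both having mass above \<open>1/2\<close>.\<close>

lemma hit_prob_Int:
  assumes [measurable]: "A \<in> sets \<kappa>" "B \<in> sets \<kappa>"
  shows "hit_prob \<kappa> act A g + hit_prob \<kappa> act B g - 1 \<le> hit_prob \<kappa> act (A \<inter> B) g"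
proof -
  let ?P = "\<lambda>A. {x \<in> space \<kappa>. act g x \<in> A}"
  have "measure \<kappa> (?P A) \<le> measure \<kappa> (?P (A \<inter> B) \<union> (space \<kappa> - ?P B))"
    by (rule X.finite_measure_mono) auto
  also have "\<dots> \<le> measure \<kappa> (?P (A \<inter> B)) + measure \<kappa> (space \<kappa> - ?P B)"
    by (rule measure_Un_le) auto
  also have "measure \<kappa> (space \<kappa> - ?P B) = 1 - measure \<kappa> (?P B)"
    by (rule X.prob_compl) simp
  finally show ?thesis by (simp add: hit_prob_def)
qed

lemma hit_prob_le_1: "hit_prob \<kappa> act A g \<le> 1"
  by (simp add: hit_prob_def)

text \<open>Along a fixed path, the measurable sets with this property form a proper filter; by the
  zero-one limit, a given measurable set or its complement almost surely belongs to it.\<close>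

definition concentrates :: "'x set \<Rightarrow> (nat \<Rightarrow> 'g) \<Rightarrow> bool" where
  "concentrates A s \<longleftrightarrow> (\<lambda>n. hit_prob \<kappa> act A (walk s n)) \<longlonglongrightarrow> 1"

lemma concentrates_measurable [measurable]:
  assumes "A \<in> sets \<kappa>"
  shows "{s. concentrates A s} \<in> sets S"
proof -
  have [measurable]: "hit_prob \<kappa> act A \<in> borel_measurable borel"
    using harmonic_hit_prob[OF assms] by (simp add: unit_harmonic_def)
  have "{s \<in> space S. (\<lambda>n. hit_prob \<kappa> act A (walk s n)) \<longlonglongrightarrow> 1} \<in> sets S" by measurable
  then show ?thesis by (simp add: concentrates_def space_path)
qed

lemma measure_concentrates:
  assumes "A \<in> sets \<kappa>"
  shows "measure S {s. concentrates A s} = measure \<kappa> A"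
  unfolding concentrates_def
  using mean_limit_measure[OF harmonic_hit_prob zero_one_hit_prob, OF assms assms] hit_prob_0[OF assms]
  by simp

lemma concentrates_mono:
  assumes "concentrates A s" "A \<subseteq> B" "B \<in> sets \<kappa>"
  shows "concentrates B s"
  unfolding concentrates_def
proof (rule tendsto_sandwich)
  show "(\<lambda>n. hit_prob \<kappa> act A (walk s n)) \<longlonglongrightarrow> 1" using assms(1) by (simp add: concentrates_def)
  show "(\<lambda>n. 1) \<longlonglongrightarrow> (1::real)" by simp
qed (use assms hit_prob_mono hit_prob_le_1 in auto)

lemma concentrates_Int:
  assumes "concentrates A s" "concentrates B s" "A \<in> sets \<kappa>" "B \<in> sets \<kappa>"
  shows "concentrates (A \<inter> B) s"
  unfolding concentrates_def
proof (rule tendsto_sandwich)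
  have "(\<lambda>n. hit_prob \<kappa> act A (walk s n) + hit_prob \<kappa> act B (walk s n) - 1) \<longlonglongrightarrow> 1 + 1 - 1"
    using assms(1,2) unfolding concentrates_def by (intro tendsto_intros)
  then show "(\<lambda>n. hit_prob \<kappa> act A (walk s n) + hit_prob \<kappa> act B (walk s n) - 1) \<longlonglongrightarrow> 1" by simp
  show "(\<lambda>n. 1) \<longlonglongrightarrow> (1::real)" by simp
qed (use assms hit_prob_Int hit_prob_le_1 in auto)

lemma not_concentrates_empty: "\<not> concentrates {} s"
  by (simp add: concentrates_def hit_prob_def LIMSEQ_const_iff)

lemma concentrates_space: "concentrates (space \<kappa>) s"
proof -
  have "hit_prob \<kappa> act (space \<kappa>) g = 1" for g
    using hit_prob_Diff[of "{}" g] by (simp add: hit_prob_def)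
  then show ?thesis by (simp add: concentrates_def)
qed

lemma AE_concentrates_Diff:
  assumes "A \<in> sets \<kappa>"
  shows "AE s in S. \<not> concentrates A s \<longrightarrow> concentrates (space \<kappa> - A) s"
  using zero_one_hit_prob[OF assms]
proof eventually_elim
  case (elim s)
  show ?case
  proof
    assume "\<not> concentrates A s"
    then have "(\<lambda>n. hit_prob \<kappa> act A (walk s n)) \<longlonglongrightarrow> 0" using elim by (simp add: concentrates_def)
    then have "(\<lambda>n. 1 - hit_prob \<kappa> act A (walk s n)) \<longlonglongrightarrow> 1 - 0" by (intro tendsto_intros)
    then show "concentrates (space \<kappa> - A) s" by (simp add: concentrates_def hit_prob_Diff[OF assms])
  qed
qed

text \<open>If the union concentrates and no member does, then almost surely all complements
  concentrate, hence so do the remainders \<open>D n\<close> of the union. These decrease to the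
  empty set, so concentration on all of them has probability at most the limit of their
  \<kappa>-measures, which is \<open>0\<close>.\<close>

lemma AE_concentrates_Union:
  assumes "countable \<C>" "\<C> \<subseteq> sets \<kappa>"
  shows "AE s in S. concentrates (\<Union>\<C>) s \<longrightarrow> (\<exists>A\<in>\<C>. concentrates A s)"
proof (cases "\<C> = {}")
  case True
  then show ?thesis by (simp add: not_concentrates_empty)
next
  case False
  define C where "C = from_nat_into \<C>"
  have C: "range C = \<C>" unfolding C_def using assms(1) False by (rule range_from_nat_into[rotated])
  then have Cm: "C n \<in> sets \<kappa>" for n using assms(2) by blast
  define D where "D n = \<Union>\<C> - (\<Union>i\<le>n. C i)" for n
  have U: "\<Union>\<C> \<in> sets \<kappa>" using assms by (rule sets.countable_Union)
  have Dm: "D n \<in> sets \<kappa>" for n unfolding D_def using U Cm by auto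
  let ?Z = "{s. concentrates (\<Union>\<C>) s \<and> (\<forall>n. concentrates (D n) s)}"
  have Z: "?Z \<in> sets S"
  proof -
    have "?Z = {s. concentrates (\<Union>\<C>) s} \<inter> (\<Inter>n. {s. concentrates (D n) s})" by auto
    then show ?thesis using concentrates_measurable[OF U] concentrates_measurable[OF Dm] by auto
  qed
  have "measure S ?Z \<le> 0"
  proof (rule LIMSEQ_le_const)
    have "(\<lambda>n. measure \<kappa> (D n)) \<longlonglongrightarrow> measure \<kappa> (\<Inter>n. D n)"
      by (rule X.finite_Lim_measure_decseq) (use Dm in \<open>auto simp: D_def decseq_def\<close>)
    moreover have "(\<Inter>n. D n) = {}" unfolding D_def using C by blast
    ultimately show "(\<lambda>n. measure \<kappa> (D n)) \<longlonglongrightarrow> 0" by simp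
    have "measure S ?Z \<le> measure \<kappa> (D n)" for n
      unfolding measure_concentrates[OF Dm, symmetric]
      by (rule P.finite_measure_mono) (use concentrates_measurable[OF Dm] in auto)
    then show "\<exists>N. \<forall>n\<ge>N. measure S ?Z \<le> measure \<kappa> (D n)" by blast
  qed
  then have "?Z \<in> null_sets S"
    using Z by (intro null_setsI) (auto simp: P.emeasure_eq_measure measure_le_0_iff)
  then have "AE s in S. s \<notin> ?Z" by (rule AE_not_in)
  moreover have "AE s in S. \<forall>n. \<not> concentrates (C n) s \<longrightarrow> concentrates (space \<kappa> - C n) s"
    by (subst AE_all_countable) (use AE_concentrates_Diff[OF Cm] in blast)
  ultimately show ?thesis
  proof eventually_elim
    case (elim s)
    show ?case
    proof (intro impI, rule ccontr)
      assume U': "concentrates (\<Union>\<C>) s" and "\<not> (\<exists>A\<in>\<C>. concentrates A s)"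
      then have compl: "concentrates (space \<kappa> - C n) s" for n using elim(2) C by blast
      have "concentrates (D n) s" for n
      proof (induction n)
        case 0
        have "D 0 = \<Union>\<C> \<inter> (space \<kappa> - C 0)"
          using sets.sets_into_space[OF U] by (auto simp: D_def)
        then show ?case using concentrates_Int[OF U' compl U] Cm by auto
      next
        case (Suc n)
        have "D (Suc n) = D n \<inter> (space \<kappa> - C (Suc n))"
          using sets.sets_into_space[OF U] by (auto simp: D_def atMost_Suc)
        then show ?case using concentrates_Int[OF Suc compl Dm] Cm by auto
      qed
      then show False using elim(1) U' by blast
    qed
  qed
qed

section \<open>Existence, location and law of the limit point\<close>

context
  fixes T :: "'x topology"
  assumes cm: "completely_metrizable_space T" and sc: "second_countable T"
    and space_eq: "space \<kappa> = topspace T" and sets_eq: "sets \<kappa> = sets (borel_of T)"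
begin

lemma countable_base:
  obtains \<B> where "countable \<B>" "\<And>V. V \<in> \<B> \<Longrightarrow> openin T V"
    "\<And>U x. openin T U \<Longrightarrow> x \<in> U \<Longrightarrow> \<exists>V\<in>\<B>. x \<in> V \<and> V \<subseteq> U"
proof -
  from sc obtain \<B> where "countable \<B>" "\<forall>V\<in>\<B>. openin T V"
    "\<forall>U x. openin T U \<and> x \<in> U \<longrightarrow> (\<exists>V\<in>\<B>. x \<in> V \<and> V \<subseteq> U)"
    unfolding second_countable_def by (elim exE conjE)
  then show thesis by (intro that[of \<B>]) simp_all
qed

lemma open_sets: "openin T U \<Longrightarrow> U \<in> sets \<kappa>"
  by (simp add: sets_eq sets_borel_of_openin)

text \<open>Weak convergence of the translates of \<kappa> by \<open>walk s n\<close> to the point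
  mass at \<open>k\<close>, tested on neighbourhoods.\<close>

definition limit_point :: "(nat \<Rightarrow> 'g) \<Rightarrow> 'x \<Rightarrow> bool" where
  "limit_point s k \<longleftrightarrow> k \<in> topspace T \<and> (\<forall>U. openin T U \<and> k \<in> U \<longrightarrow> concentrates U s)"

lemma AE_limit_point: "AE s in S. \<exists>k. limit_point s k"
proof -
  obtain Y d where Yd: "Metric_space Y d" "Metric_space.mcomplete Y d" "T = Metric_space.mtopology Y d"
    using cm unfolding completely_metrizable_space_def by blast
  interpret Y: Metric_space Y d by (rule Yd(1))
  obtain \<B> where \<B>: "countable \<B>" "\<And>V. V \<in> \<B> \<Longrightarrow> openin T V"
    "\<And>U x. openin T U \<Longrightarrow> x \<in> U \<Longrightarrow> \<exists>V\<in>\<B>. x \<in> V \<and> V \<subseteq> U"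
    by (fact countable_base)
  have top: "topspace T = Y" by (simp add: Yd(3))
  \<comment> \<open>Base sets inside balls replace the balls themselves, so that the cover at each
    scale is countable.\<close>
  define \<C> where "\<C> m = {V\<in>\<B>. \<exists>x. V \<subseteq> Y.mball x (inverse (real (Suc m)))}" for m
  have "AE s in S. \<exists>A\<in>\<C> m. concentrates A s" for m
  proof -
    have "\<Union>(\<C> m) = space \<kappa>"
    proof
      show "\<Union>(\<C> m) \<subseteq> space \<kappa>"
        using \<B>(2) openin_subset by (fastforce simp: \<C>_def space_eq)
      show "space \<kappa> \<subseteq> \<Union>(\<C> m)"
      proof
        fix x assume "x \<in> space \<kappa>"
        then have x: "x \<in> Y" by (simp add: space_eq top)
        have "openin T (Y.mball x (inverse (real (Suc m))))" by (simp add: Yd(3))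
        then obtain V where "V \<in> \<B>" "x \<in> V" "V \<subseteq> Y.mball x (inverse (real (Suc m)))"
          using \<B>(3)[of _ x] x by (metis Y.centre_in_mball_iff inverse_positive_iff_positive of_nat_0_less_iff zero_less_Suc)
        then show "x \<in> \<Union>(\<C> m)" by (auto simp: \<C>_def)
      qed
    qed
    moreover have "countable (\<C> m)" "\<C> m \<subseteq> sets \<kappa>"
      using \<B>(1,2) open_sets by (auto simp: \<C>_def)
    ultimately show ?thesis
      using AE_concentrates_Union[of "\<C> m"] by (simp add: concentrates_space)
  qed
  then have "AE s in S. \<forall>m. \<exists>A\<in>\<C> m. concentrates A s"
    by (subst AE_all_countable) blast
  then show ?thesis
  proof eventually_elim
    case (elim s)
    then obtain V where V: "\<And>m. V m \<in> \<C> m" and conc: "\<And>m. concentrates (V m) s" by metis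
    have Vm: "V m \<in> sets \<kappa>" for m using V[of m] \<B>(2) open_sets by (auto simp: \<C>_def)
    have small: "d y z < 2 * inverse (real (Suc m))" if yz: "y \<in> V m" "z \<in> V m" for y z m
    proof -
      obtain x where "V m \<subseteq> Y.mball x (inverse (real (Suc m)))" using V[of m] by (auto simp: \<C>_def)
      then have "x \<in> Y" "y \<in> Y" "z \<in> Y" "d x y < inverse (real (Suc m))" "d x z < inverse (real (Suc m))"
        using yz by auto
      then show ?thesis using Y.triangle[of y x z] by (simp add: Y.commute)
    qed
    \<comment> \<open>Finite intersections still concentrate, so they are nonempty; one point from
      each makes a Cauchy sequence.\<close>
    define W where "W m = (\<Inter>i\<le>m. V i)" for m
    have Wm: "W m \<in> sets \<kappa>" for m unfolding W_def using Vm by (intro sets.countable_INT) auto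
    have "concentrates (W m) s" for m
    proof (induction m)
      case 0
      show ?case using conc by (simp add: W_def)
    next
      case (Suc m)
      have "W (Suc m) = W m \<inter> V (Suc m)" by (auto simp: W_def atMost_Suc)
      then show ?case using concentrates_Int[OF Suc conc Wm Vm] by simp
    qed
    then have "W m \<noteq> {}" for m using not_concentrates_empty by metis
    then have "\<exists>z. z \<in> W m" for m by blast
    then obtain y where y: "\<And>m. y m \<in> W m" by metis
    have yV: "y n \<in> V m" if "m \<le> n" for m n using y[of n] that by (auto simp: W_def)
    have VY: "V m \<subseteq> Y" for m using sets.sets_into_space[OF Vm] by (simp add: space_eq top)
    have yY: "y n \<in> Y" for n using yV[of n n] VY by auto
    have scale: "\<exists>N. 2 * inverse (real (Suc N)) < \<epsilon>" if "\<epsilon> > 0" for \<epsilon> :: real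
      using reals_Archimedean[of "\<epsilon> / 2"] that by (auto simp: field_simps)
    have "Y.MCauchy y"
      unfolding Y.MCauchy_def
    proof (intro conjI allI impI)
      show "range y \<subseteq> Y" using yY by auto
      fix \<epsilon> :: real assume "\<epsilon> > 0"
      then obtain N where "2 * inverse (real (Suc N)) < \<epsilon>" using scale by blast
      then show "\<exists>N. \<forall>n n'. N \<le> n \<longrightarrow> N \<le> n' \<longrightarrow> d (y n) (y n') < \<epsilon>"
        using small yV by (meson order_less_trans)
    qed
    then obtain k where k: "limitin Y.mtopology y k sequentially"
      using Yd(2) unfolding Y.mcomplete_def by blast
    have kY: "k \<in> Y" using k by (simp add: Y.limitin_metric)
    have "concentrates U s" if U: "openin T U" "k \<in> U" for U
    proof -
      obtain r where r: "r > 0" "Y.mball k r \<subseteq> U"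
        using U unfolding Yd(3) Y.openin_mtopology by blast
      obtain N where N: "2 * inverse (real (Suc N)) < r / 2" using scale[of "r / 2"] r by auto
      have "eventually (\<lambda>n. d (y n) k < r / 2) sequentially"
        using k r by (auto simp: Y.limitin_metric elim!: allE[of _ "r / 2"] eventually_mono)
      then have "eventually (\<lambda>n. d (y n) k < r / 2 \<and> N \<le> n) sequentially"
        using eventually_ge_at_top[of N] by (rule eventually_conj)
      then obtain n where n: "d (y n) k < r / 2" "N \<le> n"
        using eventually_happens'[OF sequentially_bot] by blast
      \<comment> \<open>The limit \<open>k\<close> may lie outside \<open>V N\<close>, which is
        open; the point \<open>y n\<close> of \<open>V N\<close> close to \<open>k\<close> bridges
        the gap.\<close>
      have "V N \<subseteq> Y.mball k r"
      proof
        fix z assume z: "z \<in> V N"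
        then have zY: "z \<in> Y" using VY by auto
        have "d k z \<le> d k (y n) + d (y n) z" using Y.triangle[OF kY yY zY] .
        also have "\<dots> < r / 2 + r / 2"
          using n(1) small[OF yV[OF n(2)] z] N Y.commute[of k "y n"] by linarith
        finally show "z \<in> Y.mball k r" using kY zY by simp
      qed
      then show ?thesis
        using concentrates_mono[OF conc[of N] _ open_sets[OF U(1)]] r(2) by blast
    qed
    then show ?case using kY by (auto simp: limit_point_def top)
  qed
qed

lemma limit_point_disjoint:
  assumes "limit_point s k" "openin T U" "k \<in> U" "A \<in> sets \<kappa>" "A \<inter> U = {}"
  shows "\<not> concentrates A s"
  using assms concentrates_Int[of A s U] open_sets[of U] not_concentrates_empty
  by (auto simp: limit_point_def)

text \<open>One direction is the definition. For the other, concentration on \<open>U\<close> must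
  be kept from drifting to its boundary: by regularity \<open>U\<close> is a countable union of base
  sets with closure inside \<open>U\<close>, one of these concentrates, and its closure has to
  contain the limit point.\<close>

lemma AE_limit_point_in_open_iff:
  assumes U: "openin T U"
  shows "AE s in S. \<forall>k. limit_point s k \<longrightarrow> (k \<in> U \<longleftrightarrow> concentrates U s)"
proof -
  obtain \<B> where \<B>: "countable \<B>" "\<And>V. V \<in> \<B> \<Longrightarrow> openin T V"
    "\<And>U x. openin T U \<Longrightarrow> x \<in> U \<Longrightarrow> \<exists>V\<in>\<B>. x \<in> V \<and> V \<subseteq> U"
    by (fact countable_base)
  have reg: "regular_space T"
    using cm completely_metrizable_imp_metrizable_space metrizable_imp_regular_space by blast
  let ?C = "{V\<in>\<B>. T closure_of V \<subseteq> U}"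
  have "\<Union>?C = U"
  proof
    show "\<Union>?C \<subseteq> U"
      using closure_of_subset[OF openin_subset[OF \<B>(2)]] by fast
    show "U \<subseteq> \<Union>?C"
    proof
      fix x assume x: "x \<in> U"
      obtain V C where VC: "openin T V" "closedin T C" "x \<in> V" "V \<subseteq> C" "C \<subseteq> U"
        using reg U x unfolding neighbourhood_base_of_closedin[symmetric] neighbourhood_base_of by metis
      obtain W where W: "W \<in> \<B>" "x \<in> W" "W \<subseteq> V" using \<B>(3)[OF VC(1,3)] by blast
      have "T closure_of W \<subseteq> C" using VC W by (intro closure_of_minimal) auto
      then have "W \<in> ?C" using W(1) VC(5) by blast
      then show "x \<in> \<Union>?C" using W(2) by blast
    qed
  qed
  moreover have "countable ?C" "?C \<subseteq> sets \<kappa>"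
    using \<B>(1,2) open_sets by auto
  ultimately have "AE s in S. concentrates U s \<longrightarrow> (\<exists>V\<in>?C. concentrates V s)"
    using AE_concentrates_Union[of ?C] by simp
  then show ?thesis
  proof eventually_elim
    case (elim s)
    show ?case
    proof (intro allI impI iffI)
      fix k assume k: "limit_point s k"
      show "concentrates U s" if "k \<in> U" using k U that by (simp add: limit_point_def)
      show "k \<in> U" if "concentrates U s"
      proof (rule ccontr)
        assume "k \<notin> U"
        obtain V where V: "V \<in> \<B>" "T closure_of V \<subseteq> U" "concentrates V s" using elim \<open>concentrates U s\<close> by blast
        have "openin T (topspace T - T closure_of V)" by (intro openin_diff) auto
        moreover have "k \<in> topspace T - T closure_of V"
          using k V \<open>k \<notin> U\<close> by (auto simp: limit_point_def)
        moreover have "V \<inter> (topspace T - T closure_of V) = {}"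
          using closure_of_subset[of V T] openin_subset[OF \<B>(2)[OF V(1)]] by auto
        ultimately show False
          using limit_point_disjoint[OF k _ _ open_sets[OF \<B>(2)[OF V(1)]]] V(3) by blast
      qed
    qed
  qed
qed

text \<open>Off a null set, membership of a limit point in a base set is read off from
  concentration, whichever limit point is chosen; this gives measurability. The law agrees with
  \<kappa> on the open sets, an intersection-stable generator.\<close>

lemma measurable_limit_map:
  obtains \<xi> where "\<xi> \<in> S \<rightarrow>\<^sub>M borel_of T" "AE s in S. limit_point s (\<xi> s)"
    "distr S (borel_of T) \<xi> = \<kappa>"
proof -
  obtain \<B> where \<B>: "countable \<B>" "\<And>V. V \<in> \<B> \<Longrightarrow> openin T V"
    "\<And>U x. openin T U \<Longrightarrow> x \<in> U \<Longrightarrow> \<exists>V\<in>\<B>. x \<in> V \<and> V \<subseteq> U"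
    by (fact countable_base)
  have "AE s in S. \<forall>U\<in>\<B>. \<forall>k. limit_point s k \<longrightarrow> (k \<in> U \<longleftrightarrow> concentrates U s)"
    using AE_limit_point_in_open_iff \<B> by (subst AE_ball_countable) auto
  then have "AE s in S. (\<exists>k. limit_point s k) \<and> (\<forall>U\<in>\<B>. \<forall>k. limit_point s k \<longrightarrow> (k \<in> U \<longleftrightarrow> concentrates U s))"
    using AE_limit_point by (rule AE_conjI[rotated])
  then obtain N where N: "N \<in> null_sets S"
    and good: "\<And>s. s \<notin> N \<Longrightarrow> (\<exists>k. limit_point s k) \<and> (\<forall>U\<in>\<B>. \<forall>k. limit_point s k \<longrightarrow> (k \<in> U \<longleftrightarrow> concentrates U s))"
    by (elim AE_E3) (auto simp: space_path)
  obtain x0 where x0: "x0 \<in> topspace T" using X.not_empty unfolding space_eq by blast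
  \<comment> \<open>The default \<open>x0\<close> keeps all values in \<open>topspace T\<close>; as
    \<open>N\<close> is measurable, the preimages stay measurable.\<close>
  define \<xi> where "\<xi> s = (if s \<in> N then x0 else (SOME k. limit_point s k))" for s
  have lp: "limit_point s (\<xi> s)" if "s \<notin> N" for s
    using good[OF that] someI_ex[of "limit_point s"] that by (simp add: \<xi>_def)
  have top: "\<xi> s \<in> topspace T" for s
    using lp[of s] x0 by (cases "s \<in> N") (auto simp: \<xi>_def limit_point_def)
  have base: "\<xi> -` V \<in> sets S" if V: "V \<in> \<B>" for V
  proof -
    have "\<xi> -` V = ({s. concentrates V s} - N) \<union> (if x0 \<in> V then N else {})"
    proof (rule set_eqI)
      fix s
      show "s \<in> \<xi> -` V \<longleftrightarrow> s \<in> ({s. concentrates V s} - N) \<union> (if x0 \<in> V then N else {})"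
      proof (cases "s \<in> N")
        case True
        then show ?thesis by (simp add: \<xi>_def)
      next
        case False
        then show ?thesis using good[OF False] lp[OF False] V by auto
      qed
    qed
    then show ?thesis
      using concentrates_measurable[OF open_sets[OF \<B>(2)[OF V]]] N by auto
  qed
  have meas: "\<xi> \<in> S \<rightarrow>\<^sub>M borel_of T"
    unfolding borel_of_def
  proof (rule measurable_measure_of)
    show "{U. openin T U} \<subseteq> Pow (topspace T)" using openin_subset by auto
    show "\<xi> \<in> space S \<rightarrow> topspace T" using top by auto
    fix U assume "U \<in> {U. openin T U}"
    then have "\<xi> -` U \<inter> space S = (\<Union>V\<in>{V\<in>\<B>. V \<subseteq> U}. \<xi> -` V)"
      using \<B>(3)[of U] by (fastforce simp: space_path)
    then show "\<xi> -` U \<inter> space S \<in> sets S"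
      using \<B>(1) base by (auto intro!: sets.countable_UN')
  qed
  have AE_lp: "AE s in S. limit_point s (\<xi> s)"
    using AE_not_in[OF N] by eventually_elim (rule lp)
  have open_law: "emeasure (distr S (borel_of T) \<xi>) U = emeasure \<kappa> U" if U: "openin T U" for U
  proof -
    have "emeasure (distr S (borel_of T) \<xi>) U = emeasure S (\<xi> -` U \<inter> space S)"
      by (rule emeasure_distr[OF meas sets_borel_of_openin[OF U]])
    also have "\<dots> = emeasure S {s. concentrates U s}"
    proof (rule emeasure_eq_AE)
      show "AE s in S. s \<in> \<xi> -` U \<inter> space S \<longleftrightarrow> s \<in> {s. concentrates U s}"
        using AE_lp AE_limit_point_in_open_iff[OF U]
        by eventually_elim (auto simp: space_path)
      show "\<xi> -` U \<inter> space S \<in> sets S"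
        by (rule measurable_sets[OF meas sets_borel_of_openin[OF U]])
    qed (rule concentrates_measurable[OF open_sets[OF U]])
    also have "\<dots> = emeasure \<kappa> U"
      by (simp add: P.emeasure_eq_measure X.emeasure_eq_measure measure_concentrates[OF open_sets[OF U]])
    finally show ?thesis .
  qed
  have "distr S (borel_of T) \<xi> = \<kappa>"
  proof (rule measure_eqI_generator_eq[where E="{U. openin T U}" and \<Omega>="topspace T" and A="\<lambda>_. topspace T"])
    show "Int_stable {U. openin T U}" by (auto simp: Int_stable_def)
    show "{U. openin T U} \<subseteq> Pow (topspace T)" using openin_subset by auto
    show "sets (distr S (borel_of T) \<xi>) = sigma_sets (topspace T) {U. openin T U}"
      "sets \<kappa> = sigma_sets (topspace T) {U. openin T U}"
      using \<open>{U. openin T U} \<subseteq> Pow (topspace T)\<close> by (simp_all add: sets_eq borel_of_def)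
    show "emeasure (distr S (borel_of T) \<xi>) (topspace T) \<noteq> \<infinity>" for i :: nat
      using open_law[of "topspace T"] X.emeasure_finite by simp
  qed (auto simp: open_law)
  then show thesis using that meas AE_lp by blast
qed

end

end

section \<open>The topology on the union of the group and the boundary\<close>

context boundary_walk
begin

text \<open>The group is discrete in this topology. Closure under intersections holds because
  \<open>hit_prob\<close> is monotone in the set.\<close>

definition hit_open :: "'x topology \<Rightarrow> ('g + 'x) set \<Rightarrow> bool" where
  "hit_open T W \<longleftrightarrow> openin T (Inr -` W) \<and>
     (\<forall>x. Inr x \<in> W \<longrightarrow> (\<exists>U. openin T U \<and> x \<in> U \<and> (\<forall>g. 1/2 < hit_prob \<kappa> act U g \<longrightarrow> Inl g \<in> W)))"

definition hit_topology :: "'x topology \<Rightarrow> ('g + 'x) topology" where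
  "hit_topology T = topology (hit_open T)"

lemma openin_hit_topology:
  assumes T: "\<And>U. openin T U \<Longrightarrow> U \<in> sets \<kappa>"
  shows "openin (hit_topology T) = hit_open T"
proof -
  have "istopology (hit_open T)"
    unfolding istopology_def
  proof (intro conjI allI impI)
    fix W W' assume W: "hit_open T W" and W': "hit_open T W'"
    show "hit_open T (W \<inter> W')"
      unfolding hit_open_def
    proof (intro conjI allI impI)
      show "openin T (Inr -` (W \<inter> W'))" using W W' by (simp add: hit_open_def openin_Int)
      fix x :: 'x assume x: "Inr x \<in> W \<inter> W'"
      obtain U where U: "openin T U" "x \<in> U" "\<And>g. 1/2 < hit_prob \<kappa> act U g \<Longrightarrow> Inl g \<in> W"
        using W x unfolding hit_open_def by blast
      obtain U' where U': "openin T U'" "x \<in> U'" "\<And>g. 1/2 < hit_prob \<kappa> act U' g \<Longrightarrow> Inl g \<in> W'"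
        using W' x unfolding hit_open_def by blast
      have "hit_prob \<kappa> act (U \<inter> U') g \<le> hit_prob \<kappa> act U g"
        "hit_prob \<kappa> act (U \<inter> U') g \<le> hit_prob \<kappa> act U' g" for g
        using T U(1) U'(1) by (auto intro: hit_prob_mono)
      then have "Inl g \<in> W \<inter> W'" if "1/2 < hit_prob \<kappa> act (U \<inter> U') g" for g
        using U(3) U'(3) that by (meson IntI order_less_le_trans)
      then show "\<exists>U. openin T U \<and> x \<in> U \<and> (\<forall>g. 1/2 < hit_prob \<kappa> act U g \<longrightarrow> Inl g \<in> W \<inter> W')"
        using U U' by (intro exI[of _ "U \<inter> U'"]) auto
    qed
  next
    fix \<W> assume W: "\<forall>W\<in>\<W>. hit_open T W"
    have "Inr -` \<Union>\<W> = (\<Union>W\<in>\<W>. Inr -` W)" by auto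
    then have "openin T (Inr -` \<Union>\<W>)" using W by (auto simp: hit_open_def)
    moreover have "\<exists>U. openin T U \<and> x \<in> U \<and> (\<forall>g. 1/2 < hit_prob \<kappa> act U g \<longrightarrow> Inl g \<in> \<Union>\<W>)"
      if "Inr x \<in> \<Union>\<W>" for x
      using that W unfolding hit_open_def by (meson UnionE UnionI)
    ultimately show "hit_open T (\<Union>\<W>)" unfolding hit_open_def by blast
  qed
  then show ?thesis by (simp add: hit_topology_def topology_inverse')
qed

text \<open>Sets of the first kind are neighbourhoods against which convergence to a boundary point
  is tested; those of the second kind serve to recover \<open>T\<close> as the subspace topology of
  the boundary.\<close>

lemma hit_open_basic:
  assumes "openin T U"
  shows "hit_open T (Inl ` {g. 1/2 < hit_prob \<kappa> act U g} \<union> Inr ` U)" "hit_open T (range Inl \<union> Inr ` U)"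
proof -
  have "Inr -` (Inl ` A \<union> Inr ` U) = U" for A :: "'g set" by auto
  then show "hit_open T (Inl ` {g. 1/2 < hit_prob \<kappa> act U g} \<union> Inr ` U)" "hit_open T (range Inl \<union> Inr ` U)"
    using assms unfolding hit_open_def by auto
qed

section \<open>Assembling the hitting model\<close>

text \<open>The boundary is \<open>topspace T\<close> with its action unchanged and the hitting
  measure is \<kappa> itself, so the identity map serves as the isomorphism.\<close>

lemma hitting_model_exists: "\<exists>(T :: ('g + 'x) topology) K actK. hitting_model \<mu> \<kappa> act T K actK"
proof -
  obtain T where T: "completely_metrizable_space T" "second_countable T"
      "space \<kappa> = topspace T" "sets \<kappa> = sets (borel_of T)"
    using prob_g_space unfolding prob_g_space_def g_space_def standard_borel_def by blast
  note open_sets = open_sets[OF T]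
  let ?H = "hit_topology T" and ?K = "topspace T"
  have openH: "openin ?H W \<longleftrightarrow> hit_open T W" for W
    using openin_hit_topology open_sets by simp
  have topH: "topspace ?H = range Inl \<union> Inr ` ?K"
  proof
    show "topspace ?H \<subseteq> range Inl \<union> Inr ` ?K"
    proof
      fix z assume "z \<in> topspace ?H"
      then have "openin T (Inr -` topspace ?H)" using openH[of "topspace ?H"] by (simp add: hit_open_def)
      then show "z \<in> range Inl \<union> Inr ` ?K"
        using openin_subset \<open>z \<in> topspace ?H\<close> by (cases z) fastforce+
    qed
    show "range Inl \<union> Inr ` ?K \<subseteq> topspace ?H"
      using hit_open_basic(2)[of T ?K] openH openin_subset by blast
  qed
  \<comment> \<open>The subspace topology on the boundary is \<open>T\<close>, so the Borel
    structure there is that of \<kappa>.\<close>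
  have "openin (pullback_topology ?K Inr ?H) U \<longleftrightarrow> openin T U" for U
  proof
    assume "openin (pullback_topology ?K Inr ?H) U"
    then obtain W where "hit_open T W" "U = Inr -` W \<inter> ?K"
      by (auto simp: openin_pullback_topology openH)
    then show "openin T U" by (auto simp: hit_open_def)
  next
    assume U: "openin T U"
    have "U = Inr -` (range Inl \<union> Inr ` U) \<inter> ?K" using openin_subset[OF U] by auto
    then show "openin (pullback_topology ?K Inr ?H) U"
      unfolding openin_pullback_topology openH using hit_open_basic(2)[OF U] by blast
  qed
  then have bb: "boundary_borel ?H ?K = borel_of T"
    unfolding boundary_borel_def by (metis topology_eq)
  have lim: "walk_limit ?H ?K s k" if k: "limit_point T s k" for s k
    unfolding walk_limit_def limitin_def
  proof (intro conjI allI impI)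
    show kT: "k \<in> ?K" using k by (simp add: limit_point_def[OF T])
    then show "Inr k \<in> topspace ?H" by (simp add: topH)
    fix W assume "openin ?H W \<and> Inr k \<in> W"
    then obtain U where U: "openin T U" "k \<in> U" "\<And>g. 1/2 < hit_prob \<kappa> act U g \<Longrightarrow> Inl g \<in> W"
      unfolding openH hit_open_def by blast
    have "concentrates U s" using k U by (simp add: limit_point_def[OF T])
    then have "eventually (\<lambda>n. 1/2 < hit_prob \<kappa> act U (walk s n)) sequentially"
      unfolding concentrates_def by (rule order_tendstoD) simp
    then show "eventually (\<lambda>n. Inl (walk s n) \<in> W) sequentially"
      by eventually_elim (rule U(3))
  qed
  \<comment> \<open>Disjoint neighbourhoods of two different limits would both eventually carry mass
    above \<open>1/2\<close>.\<close>
  have unique: "k' = k" if k: "limit_point T s k" and k': "walk_limit ?H ?K s k'" for s k k'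
  proof (rule ccontr)
    assume ne: "k' \<noteq> k"
    have "Hausdorff_space T"
      using T(1) completely_metrizable_imp_metrizable_space metrizable_imp_Hausdorff_space by blast
    moreover have "k \<in> ?K" "k' \<in> ?K"
      using k k' by (auto simp: limit_point_def[OF T] walk_limit_def)
    ultimately obtain U U' where U: "openin T U" "openin T U'" "k \<in> U" "k' \<in> U'" "disjnt U U'"
      using ne unfolding Hausdorff_space_def by metis
    have "concentrates U s" using k U by (simp add: limit_point_def[OF T])
    then have "eventually (\<lambda>n. 1/2 < hit_prob \<kappa> act U (walk s n)) sequentially"
      unfolding concentrates_def by (rule order_tendstoD) simp
    moreover have "eventually (\<lambda>n. 1/2 < hit_prob \<kappa> act U' (walk s n)) sequentially"
    proof -
      let ?W = "Inl ` {g. 1/2 < hit_prob \<kappa> act U' g} \<union> Inr ` U'"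
      have "openin ?H ?W" "Inr k' \<in> ?W" using hit_open_basic(1)[OF U(2)] U(4) by (auto simp: openH)
      then have "eventually (\<lambda>n. Inl (walk s n) \<in> ?W) sequentially"
        using k' unfolding walk_limit_def limitin_def by blast
      then show ?thesis by eventually_elim auto
    qed
    ultimately have "eventually (\<lambda>n. False) sequentially"
    proof eventually_elim
      case (elim n)
      have "hit_prob \<kappa> act U (walk s n) + hit_prob \<kappa> act U' (walk s n) - 1 \<le> hit_prob \<kappa> act (U \<inter> U') (walk s n)"
        by (rule hit_prob_Int) (use open_sets U in auto)
      moreover have "hit_prob \<kappa> act (U \<inter> U') (walk s n) = 0"
        using U(5) by (simp add: disjnt_def hit_prob_def)
      ultimately show False using elim by linarith
    qed
    then show False by simp
  qed
  obtain \<xi> where \<xi>: "\<xi> \<in> S \<rightarrow>\<^sub>M borel_of T" "AE s in S. limit_point T s (\<xi> s)"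
      "distr S (borel_of T) \<xi> = \<kappa>"
    using measurable_limit_map[OF T] .
  have hm: "hitting_measure \<mu> ?H ?K \<kappa>"
    unfolding hitting_measure_def bb increments_def
  proof (intro conjI exI[of _ \<xi>])
    show "AE s in S. \<exists>!k. walk_limit ?H ?K s k"
      using \<xi>(2) by eventually_elim (use lim unique in blast)
    show "AE s in S. walk_limit ?H ?K s (\<xi> s)"
      using \<xi>(2) by eventually_elim (rule lim)
  qed (use \<xi> in simp_all)
  \<comment> \<open>\<open>borel_of T\<close> and \<kappa> are different measures with the same
    measurable sets, and the notion of a \<open>g_space\<close> depends on these sets only.\<close>
  have "g_space (borel_of T) act"
  proof -
    have "standard_borel (borel_of T)"
      unfolding standard_borel_def using T(1,2) by (intro exI[of _ T]) (simp add: space_borel_of)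
    moreover have "(\<lambda>(g, x). act g x) \<in> borel \<Otimes>\<^sub>M borel_of T \<rightarrow>\<^sub>M borel_of T"
    proof -
      have "(\<lambda>(g, x). act g x) \<in> borel \<Otimes>\<^sub>M \<kappa> \<rightarrow>\<^sub>M \<kappa>"
        using prob_g_space by (simp add: prob_g_space_def g_space_def)
      then show ?thesis
        by (simp add: measurable_cong_sets[OF sets_pair_measure_cong[OF refl T(4)] T(4)])
    qed
    ultimately show ?thesis
      using prob_g_space T(3) by (simp add: prob_g_space_def g_space_def space_borel_of)
  qed
  moreover have "g_factor_map \<kappa> act \<kappa> act (\<lambda>x. x)"
    by (simp add: g_factor_map_def distr_id2)
  then have "g_isomorphic \<kappa> act \<kappa> act"
    unfolding g_isomorphic_def by (intro exI[of _ "\<lambda>x. x"]) simp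
  ultimately have "hitting_model \<mu> \<kappa> act ?H ?K act"
    unfolding hitting_model_def bb using topH hm by blast
  then show ?thesis by blast
qed

end

theorem lemma4p3:
  fixes \<mu> :: "'g::{topological_group_add, second_countable_topology, t2_space} measure"
    and \<nu>\<^sub>B :: "'b measure" and actB :: "'g \<Rightarrow> 'b \<Rightarrow> 'b"
    and \<kappa> :: "'x measure" and actX :: "'g \<Rightarrow> 'x \<Rightarrow> 'x"
  assumes "locally_compact_space (euclidean :: 'g topology)"
    and "prob_space \<mu>" and "sets \<mu> = sets borel"
    and "admissible \<mu>"
    and "mu_boundary \<mu> \<nu>\<^sub>B actB \<kappa> actX"
  shows "\<exists>(T :: ('g + 'x) topology) K actK. hitting_model \<mu> \<kappa> actX T K actK"
proof -
  interpret random_walk \<mu>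
    using assms(2,3) by (simp add: random_walk_def random_walk_axioms_def sequence_space_def product_prob_spaceI)
  obtain \<pi> where pb: "poisson_boundary \<mu> \<nu>\<^sub>B actB" and X: "prob_g_space \<kappa> actX"
    and \<pi>: "g_factor_map \<nu>\<^sub>B actB \<kappa> actX \<pi>"
    using assms(5) unfolding mu_boundary_def by blast
  have B: "prob_g_space \<nu>\<^sub>B actB" using pb unfolding poisson_boundary_def by blast
  have "prob_space \<kappa>" using X by (simp add: prob_g_space_def)
  then have h01: "hit_prob \<kappa> actX A g \<in> {0..1}" for A g
    by (simp add: hit_prob_def prob_space.prob_le_1)
  have preimage: "\<pi> -` A \<inter> space \<nu>\<^sub>B \<in> sets \<nu>\<^sub>B" if "A \<in> sets \<kappa>" for A
    using \<pi> that by (auto simp: g_factor_map_def intro: measurable_sets)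
  \<comment> \<open>The result for indicator functions is applied to the preimage of a set
    \<open>A\<close> under \<open>\<pi>\<close>, whose transform is
    \<open>hit_prob \<kappa> actX A\<close>.\<close>
  note variance = variance_tendsto_0_indicator[OF pb preimage poisson_transform_factor[OF B X \<pi>] h01]
  have "boundary_walk \<mu> \<kappa> actX"
    by unfold_locales (use X variance AE_zero_one_limit[OF variance] in blast)+
  then show ?thesis by (rule boundary_walk.hitting_model_exists)
qed

end
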